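(* Let $p$ be an odd prime and $r\ge 1$. Let $h$ be the map which sends a pair of standard $\boldsymbol{p}$-Young tableaux of the same shape $\lambda\in V^r_0\cup V^r_1\cup\dots\cup V^r_r$ to an element of $G_r$, defined as follows. (i) If $\lambda=\lambda(k,k')\in V^r_s$ with $1\le s\le r$, and $P_i,P_j$ are the standard $\boldsymbol{p}$-Young tableaux of shape $\lambda$ with integer numbers $i,j$ ($1\le i,j\le p^{s-1}(p-1)$), then $$h(P_i,P_j)=\tau^{-(i-1)}\,g^{p^{r-s}}\,\tau^{*}\,\tau^{j-1}\,\tau^{l\,p^{s-1}(p-1)},$$ where $\tau^{*}=\tau^{p^{r-1}(p-1)/2}$ and $l=l(\lambda)$. (ii) If $\lambda=\lambda(p^{r-1}(p-1),k')\in V^r_0$, the unique pair $(P,P)$ of standard $\boldsymbol{p}$-Young tableaux of shape $\lambda$ is sent to $\tau^{j(k')}$. Then $$h:\ \bigcup_{\lambda\in V^r_0\cup V^r_1\cup\dots\cup V^r_r}\mathrm{SYT}_p(\lambda)\times \mathrm{SYT}_p(\lambda)\longrightarrow G_r$$ is a bijection.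
   Context: **Group.** $G_r=\{\tau^ig^j : 1\le i\le p^{r-1}(p-1),\ 1\le j\le p^r\}\cong \mathbb{Z}_{p^r}\rtimes\mathbb{Z}_{p^r}^*$, where $g$ has order $p^r$, $\tau$ has order $p^{r-1}(p-1)$, and $\tau^{-1}g\tau=g^{t}$ for a fixed generator $t$ of the cyclic group $\mathbb{Z}_{p^r}^*$. **Hooks and blocks.** $\lambda(k,i)$ denotes the hook partition $[k-i,1^i]$ with $k$ boxes. Adding the block $B_{m,n}$ to a hook means adding $m$ nodes at the end of the first row and $n$ nodes at the end of the first column. **Index sets.** For $r\ge 1$: $V^r_0=W^r_0=\{\lambda(p^{r-1}(p-1),i): 0\le i<p^{r-1}(p-1)\}$. For $1\le s\le r$: $V^r_s=\{\lambda(p^{r-s}[2sp-(2s+1)],i): p^{r-s}[sp-(s+1)]\le i<sp^{r-s}(p-1)\}$. For $1\le s\le r-1$: $W^r_s=\{\lambda(p^{r-s-1}[(2s+1)p-2(s+1)],i): p^{r-s-1}[sp-(s+1)]\le i<(s+1)p^{r-s-1}(p-1)\}$. **Standard $\boldsymbol{p}$-Young tableaux.** A shape in $V^r_0$ has exactly one standard $\boldsymbol{p}$-Young tableau (a single block, all nodes filled with $1$). For $\lambda\in V^r_s$, $1\le s\le r$, put $q=p^{r-s}$. A standard $\boldsymbol{p}$-Young tableau of shape $\lambda$ is a chain of hooks $\lambda^{(1)},\lambda^{(2)},\dots,\lambda^{(2s)}=\lambda$ with $\lambda^{(2m-1)}\in W^{r-s+m}_{m-1}$ and $\lambda^{(2m)}\in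 V^{r-s+m}_m$ for $1\le m\le s$, where $\lambda^{(2)}$ is obtained from $\lambda^{(1)}$ by adding a block $B_{q(p-2-t'),\,qt'}$ with $0\le t'\le p-2$, and for $n\ge 3$, $\lambda^{(n)}$ is obtained from $\lambda^{(n-1)}$ by adding a block $B_{q(p-1-t'),\,qt'}$ with $0\le t'\le p-1$. (The nodes of the $n$-th block are filled with $n$; the first block is $\lambda^{(1)}$.) $\mathrm{SYT}_p(\lambda)$ is the set of these. **Numbers of block types.** For $q$ a power of $p$, the block type $B_{q(p-1)/2+qm,\;q(p-1)/2-qm}$ has number $2m+1$ ($0\le m\le\frac{p-1}{2}$), and $B_{q(p-1)/2-qm,\;q(p-1)/2+qm}$ has number $2m$ ($1\le m\le \frac{p-1}{2}$). **Integer number of a tableau.** Let $(\lambda^{(1)},\dots,\lambda^{(2s)})$ be a standard $\boldsymbol{p}$-Young tableau of shape in $V^r_s$. For $1\le n\le s-1$ let $i_n\in\{1,\dots,p\}$ be the number of the type of the block added in passing from $\lambda^{(2(s-n+1)-1)}$ to $\lambda^{(2(s-n+1))}$ (so $i_1$ comes from the last block). - If $s=r$: write $\lambda^{(1)}=\lambda(p-1,u)$, $0\le u\le p-2$. Let $i_r=2u+1$ if $u<\frac{p-1}{2}$, and $i_r=2(t_1+1)$ if $u=p-2-t_1$ with $0\le t_1<\frac{p-1}{2}$. The number of the tableau is $i_1+p(i_2-1)+\dots+p^{r-2}(i_{r-1}-1)+p^{r-1}(i_r-1)$ (for $r=1$ it is $i_1$). - If $1\le s\le r-1$: write $\lambda^{(1)}=\lambda(p^{r-s}(p-1),u)$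 and let $j'$ be the integer with $j'p^{r-s}\le u<(j'+1)p^{r-s}$. The number is $1+j'+p^{s-2}(p-1)(i_1-1)+\sum_{n=1}^{s-2}p^{n-1}(p-1)(i_{n+1}-1)$ if $s>1$, and $1+j'$ if $s=1$. $P_j$ denotes the tableau of the given shape with number $j$. **The integer $l(\lambda)$.** For $\lambda=\lambda(k,k')\in V^r_s$, $1\le s\le r$, $k=p^{r-s}[2sp-(2s+1)]$, write $k'=\frac{k-1}{2}+\sum_{i=1}^{r-s}\varepsilon_i p^{r-s-i}j_i$ with $\varepsilon_i\in\{1,-1\}$, $0\le j_i\le\frac{p-1}{2}$. Then $l(\lambda)=(p-1)\sum_{i=1}^{r-s}p^{r-s-i}\nu(j_i)$, where $\nu(j_i)=0$ if $j_i=0$, and otherwise $\nu(j_i)=2j_i$ if $\varepsilon_i=-1$ and $\nu(j_i)=2j_i-1$ if $\varepsilon_i=1$. Only $l$ modulo $p^{r-s}$ matters. (For $s=r$, $l=0$.) **One-dimensional shapes.** $k'\mapsto j(k')$ is a fixed bijection from $\{0,\dots,p^{r-1}(p-1)-1\}$ to itself (matching $\lambda(p^{r-1}(p-1),k')$ with the one-dimensional representation it indexes). *)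

theory Defs
  imports "HOL-Algebra.Multiplicative_Group" "HOL-Number_Theory.Residue_Primitive_Roots"
begin

text \<open>
  Partitions are lists of natural numbers, the rows of the diagram. In the families below
  every natural-number subtraction and every \<open>div 2\<close> is exact when \<open>p\<close> is an odd prime and the
  indices lie in the stated ranges.
\<close>

text \<open>The hook \<open>[k - i, 1\<^sup>i]\<close> (for \<open>i < k\<close>).\<close>

definition hook :: "nat \<Rightarrow> nat \<Rightarrow> nat list" where
  "hook k i = (k - i) # replicate i 1"

definition hook_leg :: "nat list \<Rightarrow> nat" where
  "hook_leg lam = length lam - 1"

lemma hook_recover:
  assumes "i < k"
  shows "sum_list (hook k i) = k" "hook_leg (hook k i) = i"
  using assms by (simp_all add: hook_def hook_leg_def sum_list_replicate)

text \<open>Adding the block \<open>B\<^bsub>m,n\<^esub>\<close>: \<open>m\<close> nodes in the first row, \<open>n\<close> nodes in the first column.\<close>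

definition add_block :: "nat \<Rightarrow> nat \<Rightarrow> nat list \<Rightarrow> nat list" where
  "add_block m n lam = (hd lam + m) # tl lam @ replicate n 1"

lemma add_block_hook:
  assumes "i < k"
  shows "add_block m n (hook k i) = hook (k + m + n) (i + n)"
  using assms by (simp add: add_block_def hook_def replicate_add)

definition V :: "nat \<Rightarrow> nat \<Rightarrow> nat \<Rightarrow> nat list set" where
  "V p r s =
    (if s = 0 then {hook (p^(r-1) * (p-1)) i | i. i < p^(r-1) * (p-1)}
     else {hook (p^(r-s) * (2*s*p - (2*s+1))) i | i.
             p^(r-s) * (s*p - (s+1)) \<le> i \<and> i < s * p^(r-s) * (p-1)})"

definition W :: "nat \<Rightarrow> nat \<Rightarrow> nat \<Rightarrow> nat list set" where
  "W p r s =
    (if s = 0 then {hook (p^(r-1) * (p-1)) i | i. i < p^(r-1) * (p-1)}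
     else {hook (p^(r-s-1) * ((2*s+1)*p - 2*(s+1))) i | i.
             p^(r-s-1) * (s*p - (s+1)) \<le> i \<and> i < (s+1) * p^(r-s-1) * (p-1)})"

text \<open>
  A tableau is the list of the hooks \<open>\<lambda>\<^sup>(\<^sup>1\<^sup>), \<lambda>\<^sup>(\<^sup>2\<^sup>), \<dots>\<close>; here
  superscripts start at 1, list indices at 0. The shape is the last entry.
\<close>

definition step :: "nat list list \<Rightarrow> nat \<Rightarrow> nat list" where
  "step T n = T ! (n - 1)"

definition is_chain :: "nat \<Rightarrow> nat \<Rightarrow> nat \<Rightarrow> nat list list \<Rightarrow> bool" where
  "is_chain p r s T \<longleftrightarrow>
     length T = 2 * s \<and>
     (\<forall>m\<in>{1..s}. step T (2*m - 1) \<in> W p (r - s + m) (m - 1) \<and>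
                 step T (2*m) \<in> V p (r - s + m) m) \<and>
     (\<exists>t\<in>{0..p-2}. step T 2 = add_block (p^(r-s) * (p-2-t)) (p^(r-s) * t) (step T 1)) \<and>
     (\<forall>n\<in>{3..2*s}. \<exists>t\<in>{0..p-1}.
        step T n = add_block (p^(r-s) * (p-1-t)) (p^(r-s) * t) (step T (n - 1)))"

definition SYT :: "nat \<Rightarrow> nat \<Rightarrow> nat list \<Rightarrow> nat list list set" where
  "SYT p r lam =
     {T. (lam \<in> V p r 0 \<and> T = [lam]) \<or>
         (\<exists>s\<in>{1..r}. lam \<in> V p r s \<and> is_chain p r s T \<and> last T = lam)}"

text \<open>The number of the type of the block added in passing from \<open>lam\<close> to \<open>mu\<close>.\<close>

definition block_number :: "nat \<Rightarrow> nat \<Rightarrow> nat list \<Rightarrow> nat list \<Rightarrow> nat" where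
  "block_number p q lam mu =
     (THE c.
        (\<exists>m\<in>{0..(p-1) div 2}. c = 2*m + 1 \<and>
           mu = add_block (q * ((p-1) div 2) + q*m) (q * ((p-1) div 2) - q*m) lam) \<or>
        (\<exists>m\<in>{1..(p-1) div 2}. c = 2*m \<and>
           mu = add_block (q * ((p-1) div 2) - q*m) (q * ((p-1) div 2) + q*m) lam))"

text \<open>
  The integer number of a tableau of shape in \<open>V p r s\<close> with \<open>1 \<le> s \<le> r\<close>; such a tableau has
  \<open>2 * s\<close> blocks. In the case \<open>s = r\<close>, \<open>u = p - 2 - t\<^sub>1\<close> is solved for \<open>t\<^sub>1\<close>; the index \<open>i\<^sub>r\<close>
  comes from the first hook, the others from the blocks. In the other case, \<open>j'\<close> with
  \<open>j' q \<le> u < (j' + 1) q\<close> is \<open>u div q\<close>.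
\<close>

definition tableau_number :: "nat \<Rightarrow> nat \<Rightarrow> nat list list \<Rightarrow> nat" where
  "tableau_number p r T =
     (let s = length T div 2;
          q = p^(r-s);
          u = hook_leg (step T 1);
          b = (\<lambda>n. block_number p q (step T (2*(s-n+1) - 1)) (step T (2*(s-n+1))))
      in if s = r then
           (let i = (\<lambda>n. if n = r
                         then (if u < (p-1) div 2 then 2*u + 1 else 2*((p-2-u) + 1))
                         else b n)
            in i 1 + (\<Sum>n=2..r. p^(n-1) * (i n - 1)))
         else
           1 + u div q +
           (if s > 1 then p^(s-2) * (p-1) * (b 1 - 1)
                          + (\<Sum>n=1..s-2. p^(n-1) * (p-1) * (b (n+1) - 1))
            else 0))"

definition nu :: "int \<Rightarrow> nat \<Rightarrow> nat" where
  "nu e j = (if j = 0 then 0 else if e = -1 then 2*j else 2*j - 1)"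

text \<open>
  The sign of a zero digit is not determined by the expansion, but does not affect the value.
\<close>

definition l_value :: "nat \<Rightarrow> nat \<Rightarrow> nat \<Rightarrow> nat list \<Rightarrow> nat" where
  "l_value p r s lam =
     (THE l. \<exists>(e :: nat \<Rightarrow> int) (j :: nat \<Rightarrow> nat).
        (\<forall>i\<in>{1..r-s}. e i \<in> {1, -1} \<and> j i \<le> (p-1) div 2) \<and>
        int (hook_leg lam) =
          (int (sum_list lam) - 1) div 2 + (\<Sum>i=1..r-s. e i * int (p^(r-s-i)) * int (j i)) \<and>
        l = (p-1) * (\<Sum>i=1..r-s. p^(r-s-i) * nu (e i) (j i)))"

text \<open>
  The map \<open>h\<close>; \<open>jj\<close> is the fixed bijection \<open>k' \<mapsto> j(k')\<close>. The exponent of the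
  first factor is an integer, the other exponents are natural numbers.
\<close>

definition h_map ::
  "('a, 'b) monoid_scheme \<Rightarrow> nat \<Rightarrow> nat \<Rightarrow> 'a \<Rightarrow> 'a \<Rightarrow> (nat \<Rightarrow> nat)
     \<Rightarrow> nat list list \<times> nat list list \<Rightarrow> 'a" where
  "h_map G p r g \<tau> jj = (\<lambda>(S, T).
     let lam = last S in
     if lam \<in> V p r 0 then \<tau> [^]\<^bsub>G\<^esub> jj (hook_leg lam)
     else
       (let s = length S div 2;
            i = tableau_number p r S;
            j = tableau_number p r T
        in \<tau> [^]\<^bsub>G\<^esub> (- (int i - 1)) \<otimes>\<^bsub>G\<^esub> g [^]\<^bsub>G\<^esub> (p^(r-s)) \<otimes>\<^bsub>G\<^esub>
           \<tau> [^]\<^bsub>G\<^esub> (p^(r-1) * (p-1) div 2) \<otimes>\<^bsub>G\<^esub> \<tau> [^]\<^bsub>G\<^esub> (j - 1) \<otimes>\<^bsub>G\<^esub>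
           \<tau> [^]\<^bsub>G\<^esub> (l_value p r s lam * p^(s-1) * (p-1))))"

end

theory Submission
  imports Defs
begin

text \<open>
  Along a chain of shape in \<open>V p r s\<close> all legs agree modulo \<open>q = p\<^sup>r\<^sup>-\<^sup>s\<close>, and the bounds in \<open>V\<close> and \<open>W\<close>
  leave a free choice only for the first hook (\<open>p - 1\<close> values) and for each of the \<open>s - 1\<close> later odd
  hooks (\<open>p\<close> values). The number of a tableau reads these choices as digits, and \<open>l_value\<close> reads the
  balanced base-\<open>p\<close> expansion of the leg, so both are injective. In \<open>G\<close>, moving \<open>\<tau>\<^sup>-\<^sup>a\<close> across \<open>g\<^sup>q\<close> gives
  \<open>g ^ (q * t ^ a) * \<tau> ^ m\<close>; the \<open>p\<close>-part of the exponent of \<open>g\<close> determines \<open>s\<close>, its unit part determines \<open>a\<close>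
  since \<open>t\<close> is a primitive root, and \<open>m\<close> determines the second tableau and the shape. Injectivity
  suffices, because both sides have \<open>p\<^sup>r * p\<^sup>r\<^sup>-\<^sup>1 * (p - 1)\<close> elements.
\<close>

section \<open>Digit expansions\<close>

lemma digits_lessThan:
  fixes p :: nat
  assumes "\<forall>k<n. x k < p"
  shows "(\<Sum>k<n. p^k * x k) < p^n"
  using assms
proof (induction n)
  case (Suc n)
  have "(\<Sum>k<Suc n. p^k * x k) < p^n + p^n * x n" using Suc by simp
  also have "\<dots> = p^n * Suc (x n)" by simp
  also have "\<dots> \<le> p^n * p" using Suc.prems by (intro mult_left_mono) (auto simp: Suc_le_eq)
  finally show ?case by (simp add: mult.commute)
qed simp

lemma digits_inj_lessThan:
  fixes p :: nat
  assumes "\<forall>k<n. x k < p" "\<forall>k<n. y k < p"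
    and "(\<Sum>k<n. p^k * x k) = (\<Sum>k<n. p^k * y k)"
  shows "\<forall>k<n. x k = y k"
  using assms
proof (induction n)
  case (Suc n)
  have split: "(\<Sum>k<Suc n. p^k * z k) div p^n = z n \<and> (\<Sum>k<Suc n. p^k * z k) mod p^n = (\<Sum>k<n. p^k * z k)"
    if "\<forall>k<Suc n. z k < p" for z
  proof -
    have "(\<Sum>k<n. p^k * z k) < p^n" using that by (intro digits_lessThan) simp
    moreover have "p > 0" using that by (cases p) auto
    ultimately show ?thesis by simp
  qed
  have sums: "x n = y n" "(\<Sum>k<n. p^k * x k) = (\<Sum>k<n. p^k * y k)"
    using split[OF Suc.prems(1)] split[OF Suc.prems(2)] Suc.prems(3) by metis+
  have "\<forall>k<n. x k = y k"
    by (rule Suc.IH) (use Suc.prems sums(2) in auto)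
  with sums(1) show ?case by (simp add: less_Suc_eq)
qed simp

lemma digits_ex_lessThan:
  fixes p :: nat
  assumes "m < p^n"
  shows "\<exists>x. (\<forall>k<n. x k < p) \<and> (\<Sum>k<n. p^k * x k) = m"
  using assms
proof (induction n arbitrary: m)
  case (Suc n)
  have "p > 0" using Suc.prems by (cases p) auto
  then have "m mod p^n < p^n" by simp
  from Suc.IH[OF this] obtain x where x: "\<forall>k<n. x k < p" "(\<Sum>k<n. p^k * x k) = m mod p^n" by blast
  have "m div p^n < p" using Suc.prems by (simp add: less_mult_imp_div_less mult.commute)
  then show ?case using x
    by (intro exI[of _ "x(n := m div p^n)"]) (auto simp: less_Suc_eq)
qed simp

text \<open>The place values come from an arbitrary bijection \<open>w\<close> because three orders
  of digits occur later: \<open>n - 1\<close>, \<open>rot_weight s n\<close> and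
  \<open>n - i\<close>.\<close>

lemma digits_reindex:
  fixes p :: nat
  assumes "bij_betw w I {..<n}"
  shows "(\<Sum>i\<in>I. p^w i * x i) = (\<Sum>k<n. p^k * x (the_inv_into I w k))"
  using assms
  by (subst sum.reindex_bij_betw[OF assms, symmetric])
     (auto intro!: sum.cong simp: the_inv_into_f_f bij_betw_def)

lemma the_inv_into_mem:
  assumes "bij_betw w I {..<n}" "k < n"
  shows "the_inv_into I w k \<in> I"
  using assms by (metis bij_betwE bij_betw_the_inv_into lessThan_iff)

lemma digits_less:
  fixes p :: nat
  assumes "bij_betw w I {..<n}" and "\<forall>i\<in>I. x i < p"
  shows "(\<Sum>i\<in>I. p^w i * x i) < p^n"
  using assms the_inv_into_mem[OF assms(1)]
  by (simp add: digits_reindex digits_lessThan)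

lemma digits_inj:
  fixes p :: nat
  assumes w: "bij_betw w I {..<n}" and x: "\<forall>i\<in>I. x i < p" "\<forall>i\<in>I. y i < p"
    and eq: "(\<Sum>i\<in>I. p^w i * x i) = (\<Sum>i\<in>I. p^w i * y i)"
    and i: "i \<in> I"
  shows "x i = y i"
proof -
  have "\<forall>k<n. x (the_inv_into I w k) = y (the_inv_into I w k)"
    using x eq the_inv_into_mem[OF w] unfolding digits_reindex[OF w]
    by (intro digits_inj_lessThan) auto
  moreover have "w i < n" "the_inv_into I w (w i) = i"
    using w i by (auto simp: bij_betw_def the_inv_into_f_f)
  ultimately show ?thesis by metis
qed

lemma digits_ex:
  fixes p :: nat
  assumes w: "bij_betw w I {..<n}" and "m < p^n"
  obtains x where "\<forall>i\<in>I. x i < p" "(\<Sum>i\<in>I. p^w i * x i) = m"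
proof -
  obtain x where x: "\<forall>k<n. x k < p" "(\<Sum>k<n. p^k * x k) = m"
    using digits_ex_lessThan[OF assms(2)] by blast
  have "\<forall>i\<in>I. x (w i) < p" using w x(1) by (auto simp: bij_betw_def)
  moreover have "(\<Sum>i\<in>I. p^w i * x (w i)) = m"
    using sum.reindex_bij_betw[OF w, of "\<lambda>k. p^k * x k"] x(2) by simp
  ultimately show ?thesis using that[of "x \<circ> w"] by simp
qed

section \<open>Powers modulo prime powers\<close>

text \<open>Each \<open>p\<close>-th power gains one factor \<open>p\<close>: the cofactor of
  \<open>X - Y\<close> in \<open>X^p - Y^p\<close> is a sum of \<open>p\<close> terms, all congruent
  to \<open>Y^(p - 1)\<close> modulo \<open>p\<close>. The latter needs \<open>X\<close> and
  \<open>Y\<close> congruent modulo \<open>p\<close>, hence \<open>s > 0\<close>.\<close>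

lemma cong_power_lift:
  fixes x y :: nat
  assumes "[x = y] (mod p^s)" and "s > 0"
  shows "[x^(p^k) = y^(p^k)] (mod p^(s + k))"
proof (induction k)
  case (Suc k)
  define X Y where "X = int (x^(p^k))" and "Y = int (y^(p^k))"
  have XY: "[X = Y] (mod int p^(s+k))"
    using Suc by (simp add: X_def Y_def cong_int_iff flip: of_nat_power)
  then have c: "[X = Y] (mod int p)"
    by (rule cong_dvd_modulus) (use \<open>s > 0\<close> in \<open>simp add: dvd_power\<close>)
  have "[(\<Sum>i<p. Y^(p - Suc i) * X^i) = (\<Sum>i<p. Y^(p - Suc i) * Y^i)] (mod int p)"
    by (intro cong_sum cong_mult cong_pow c cong_refl)
  also have "(\<Sum>i<p. Y^(p - Suc i) * Y^i) = (\<Sum>i<p. Y^(p - 1))"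
    by (intro sum.cong) (auto simp flip: power_add)
  finally have "int p dvd (\<Sum>i<p. Y^(p - Suc i) * X^i)"
    by (simp add: cong_def dvd_eq_mod_eq_0)
  moreover have "int p^(s+k) dvd X - Y" using XY by (simp add: cong_iff_dvd_diff)
  ultimately have "int p^(s+k) * int p dvd X^p - Y^p"
    unfolding power_diff_sumr2 by (rule mult_dvd_mono[rotated])
  then have "[X^p = Y^p] (mod int p^(s + Suc k))"
    by (simp add: cong_iff_dvd_diff mult.commute)
  then show ?case
    by (simp add: X_def Y_def flip: of_nat_power power_mult cong_int_iff)
       (simp add: mult.commute)
qed (use assms in simp)

text \<open>Raising to the power \<open>p^(r-s)\<close> lifts the congruence to the modulus
  \<open>p^r\<close>, where the order of \<open>t\<close> is known; the factor
  \<open>p^(r-s)\<close> then cancels against the totient.\<close>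

lemma residue_primroot_prime_power_cong:
  assumes "prime p" "residue_primroot (p^r) t" "0 < s" "s \<le> r"
    and "[t^a = t^b] (mod p^s)"
  shows "[a = b] (mod p^(s-1) * (p-1))"
proof -
  have "[(t^a)^(p^(r-s)) = (t^b)^(p^(r-s))] (mod p^(s + (r-s)))"
    using assms by (intro cong_power_lift) auto
  then have "[t^(a * p^(r-s)) = t^(b * p^(r-s))] (mod p^r)"
    using assms by (simp add: power_mult)
  then have "[a * p^(r-s) = b * p^(r-s)] (mod totient (p^r))"
    using assms order_divides_expdiff[of "p^r" t] unfolding residue_primroot_def by metis
  moreover have "totient (p^r) = p^(s-1) * (p-1) * p^(r-s)"
  proof -
    have "r - 1 = (s - 1) + (r - s)" using assms by simp
    then have "p^(r-1) = p^(s-1) * p^(r-s)" by (metis power_add)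
    then show ?thesis using assms by (simp add: totient_prime_power mult_ac)
  qed
  ultimately have "[p^(r-s) * a = p^(r-s) * b] (mod p^(r-s) * (p^(s-1) * (p-1)))"
    by (simp add: mult_ac)
  then show ?thesis
    using prime_gt_0_nat[OF assms(1)] by (simp add: cong_def mult_mod_right[symmetric])
qed

text \<open>Makes the level \<open>s\<close> readable from an exponent of \<open>g\<close> that is
  known only modulo \<open>p^r\<close>.\<close>

lemma gcd_prime_power_mult:
  fixes p :: nat
  assumes "coprime u p" "s \<le> r"
  shows "gcd (p^(r-s) * u) (p^r) = p^(r-s)"
proof -
  have "p^r = p^(r-s) * p^s" using assms by (simp flip: power_add)
  then have "gcd (p^(r-s) * u) (p^r) = p^(r-s) * gcd u (p^s)" by (simp add: gcd_mult_distrib_nat)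
  also have "gcd u (p^s) = 1" using assms by (simp flip: coprime_iff_gcd_eq_1)
  finally show ?thesis by simp
qed

section \<open>Normal forms in the group\<close>

context group
begin

lemma pow_eq_iff_cong:
  assumes "x \<in> carrier G"
  shows "x [^] (m::nat) = x [^] n \<longleftrightarrow> [m = n] (mod ord x)"
proof -
  have "x [^] m = x [^] n \<longleftrightarrow> x [^] int m = x [^] int n" by (simp add: int_pow_int)
  also have "\<dots> \<longleftrightarrow> [int n = int m] (mod int (ord x))"
    by (simp only: int_pow_eq[OF assms] cong_iff_dvd_diff)
  finally show ?thesis by (simp add: cong_int_iff cong_sym_eq)
qed

lemma conj_pow:
  assumes "y \<in> carrier G" "x \<in> carrier G"
  shows "inv y \<otimes> x [^] (n::nat) \<otimes> y = (inv y \<otimes> x \<otimes> y) [^] n"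
proof (induction n)
  case (Suc n)
  have "(inv y \<otimes> x \<otimes> y) [^] Suc n = (inv y \<otimes> x [^] n \<otimes> y) \<otimes> (inv y \<otimes> x \<otimes> y)"
    by (simp add: Suc)
  also have "\<dots> = inv y \<otimes> x [^] n \<otimes> (y \<otimes> inv y) \<otimes> x \<otimes> y"
    using assms by (simp only: m_assoc inv_closed m_closed nat_pow_closed)
  also have "\<dots> = inv y \<otimes> x [^] Suc n \<otimes> y"
    using assms by (simp add: m_assoc)
  finally show ?case by simp
qed (use assms in simp)

lemma conj_by_pow:
  assumes y: "y \<in> carrier G" and x: "x \<in> carrier G" and xy: "inv y \<otimes> x \<otimes> y = x [^] (t::nat)"
  shows "inv (y [^] (m::nat)) \<otimes> x \<otimes> y [^] m = x [^] (t^m)"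
proof (induction m)
  case (Suc m)
  have "inv (y [^] Suc m) \<otimes> x \<otimes> y [^] Suc m = inv y \<otimes> (inv (y [^] m) \<otimes> x \<otimes> y [^] m) \<otimes> y"
    using x y by (simp add: inv_mult_group m_assoc)
  also have "\<dots> = x [^] (t^Suc m)"
    unfolding Suc using x y by (simp add: conj_pow xy nat_pow_pow)
  finally show ?case .
qed (use x in simp)

text \<open>Conjugating \<open>x\<close> by the two products recovers the exponent of \<open>y\<close>.\<close>

lemma pow_mult_pow_eqD:
  fixes A B m n t :: nat
  assumes y: "y \<in> carrier G" and x: "x \<in> carrier G" and xy: "inv y \<otimes> x \<otimes> y = x [^] t"
    and t: "coprime (ord x) t" "Pocklington.ord (ord x) t = ord y"
    and eq: "x [^] A \<otimes> y [^] m = x [^] B \<otimes> y [^] n"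
  shows "[A = B] (mod ord x)" and "[m = n] (mod ord y)"
proof -
  have conj: "inv (x [^] C \<otimes> y [^] k) \<otimes> x \<otimes> (x [^] C \<otimes> y [^] k) = x [^] (t^k)" for C k :: nat
  proof -
    have "inv (x [^] C \<otimes> y [^] k) \<otimes> x \<otimes> (x [^] C \<otimes> y [^] k)
        = inv (y [^] k) \<otimes> (inv (x [^] C) \<otimes> (x \<otimes> x [^] C)) \<otimes> y [^] k"
      using x y by (simp add: inv_mult_group m_assoc)
    also have "x \<otimes> x [^] C = x [^] C \<otimes> x"
      using x by (metis nat_pow_Suc nat_pow_Suc2)
    also have "inv (x [^] C) \<otimes> (x [^] C \<otimes> x) = x"
      using x by (simp flip: m_assoc)
    finally show ?thesis using conj_by_pow[OF y x xy] by simp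
  qed
  have "x [^] (t^m) = x [^] (t^n)" using conj[of A m] conj[of B n] eq by simp
  then have "[t^m = t^n] (mod ord x)" by (simp add: pow_eq_iff_cong x)
  then show mn: "[m = n] (mod ord y)" using order_divides_expdiff[OF t(1)] t(2) by simp
  then have "y [^] m = y [^] n" by (simp add: pow_eq_iff_cong y)
  then have "x [^] A = x [^] B" using eq x y by simp
  then show "[A = B] (mod ord x)" by (simp add: pow_eq_iff_cong x)
qed

text \<open>Inserting \<open>y [^] a\<close> and its inverse after the power of \<open>x\<close>
  produces a conjugate. The remaining inverse is written \<open>y [^] (ord y - a)\<close>, so that
  all exponents stay natural numbers.\<close>

lemma inv_pow_mult_eq:
  fixes a A e t :: nat
  assumes y: "y \<in> carrier G" and x: "x \<in> carrier G" and xy: "inv y \<otimes> x \<otimes> y = x [^] t"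
    and a: "a \<le> ord y"
  shows "inv (y [^] a) \<otimes> x [^] A \<otimes> y [^] e = x [^] (A * t^a) \<otimes> y [^] (ord y - a + e)"
proof -
  have "y [^] (ord y - a) \<otimes> y [^] a = \<one>"
    using a y by (simp add: nat_pow_mult)
  then have inv: "y [^] (ord y - a) = inv (y [^] a)"
    using y by (simp add: inv_equality)
  have "inv (y [^] a) \<otimes> x [^] A \<otimes> y [^] e
      = (inv (y [^] a) \<otimes> x [^] A \<otimes> y [^] a) \<otimes> (inv (y [^] a) \<otimes> y [^] e)"
    using x y by (simp add: m_assoc inv_solve_left flip: m_assoc[of "y [^] a"])
  also have "inv (y [^] a) \<otimes> x [^] A \<otimes> y [^] a = x [^] (A * t^a)"
    using x y conj_by_pow[OF y x xy] by (simp add: conj_pow nat_pow_pow mult.commute)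
  finally show ?thesis using y by (simp add: inv[symmetric] nat_pow_mult)
qed

end

section \<open>Tableaux\<close>

lemma hook_leg_hook [simp]: "hook_leg (hook k i) = i"
  by (simp add: hook_leg_def hook_def)

lemma hook_eq_iff:
  assumes "i < k" "i' < k'"
  shows "hook k i = hook k' i' \<longleftrightarrow> k = k' \<and> i = i'"
  using assms hook_recover by metis

lemma mult_add_less:
  fixes a b q w :: nat
  assumes "w < q" "a < b"
  shows "q * a + w < q * b"
proof -
  have "q * a + w < q * Suc a" using assms by simp
  also have "\<dots> \<le> q * b" using assms by (intro mult_le_mono2) simp
  finally show ?thesis .
qed

text \<open>With \<open>q = p^(r-s)\<close> these are the shapes of \<open>V p r s\<close>. Their
  legs fill one interval of length \<open>q\<close>, so a shape is named by the residue
  \<open>w\<close> of its leg modulo \<open>q\<close>. The bounds are rewritten in terms of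
  \<open>p - 1\<close>, which makes the block arithmetic visible.\<close>

definition V_hook :: "nat \<Rightarrow> nat \<Rightarrow> nat \<Rightarrow> nat \<Rightarrow> nat list" where
  "V_hook p q s w = hook (q * (2*s*(p-1) - 1)) (q * (s*(p-1) - 1) + w)"

lemma V_hook_less:
  fixes p s q w :: nat
  assumes "p \<ge> 3" "s \<ge> 1" "w < q"
  shows "q * (s*(p-1) - 1) + w < q * (2*s*(p-1) - 1)"
proof (rule mult_add_less[OF assms(3)])
  have "s * (p-1) > 0" using assms by simp
  then show "s*(p-1) - 1 < 2*s*(p-1) - 1" by linarith
qed

lemma V_hook_inj:
  assumes "p \<ge> 3" "s \<ge> 1" "w < q" "w' < q" "V_hook p q s w = V_hook p q s w'"
  shows "w = w'"
  using assms V_hook_less[of p s w q] V_hook_less[of p s w' q] by (simp add: V_hook_def hook_eq_iff)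

lemma interval_eq_image:
  fixes q a b :: nat
  shows "q * a \<le> i \<and> i < q * a + q \<longleftrightarrow> (\<exists>w<q. i = q * a + w)"
  by (auto simp: le_iff_add)

lemma V_eq:
  assumes "p \<ge> 3" "s \<ge> 1"
  shows "V p r s = V_hook p (p^(r-s)) s ` {..<p^(r-s)}"
proof -
  define c where "c = p - 1"
  have p: "p = c + 1" "c \<ge> 2" using assms by (auto simp: c_def)
  have "s * c \<ge> 1" using p assms by simp
  then have "p^(r-s) * (s*c) = p^(r-s) * (s*c - 1 + 1)" by simp
  also have "\<dots> = p^(r-s) * (s*c - 1) + p^(r-s)" by (simp only: distrib_left mult_1_right)
  finally have e: "s * p^(r-s) * (p-1) = p^(r-s) * (s*(p-1)-1) + p^(r-s)"
    by (simp only: c_def mult_ac)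
  have "2*s*p - (2*s+1) = 2*s*(p-1) - 1" "s*p - (s+1) = s*(p-1) - 1"
    by (simp_all add: p algebra_simps)
  moreover have "s \<noteq> 0" using assms by simp
  ultimately have "V p r s = {hook (p^(r-s) * (2*s*(p-1)-1)) i | i.
      p^(r-s) * (s*(p-1)-1) \<le> i \<and> i < p^(r-s) * (s*(p-1)-1) + p^(r-s)}"
    by (simp only: V_def e if_False)
  then show ?thesis unfolding interval_eq_image V_hook_def by blast
qed

text \<open>The second block has \<open>p - 2\<close> units of \<open>q\<close> nodes and every
  later one \<open>p - 1\<close>; the missing unit is the \<open>- 1\<close> for
  \<open>n > 1\<close>.\<close>

definition tab_size :: "nat \<Rightarrow> nat \<Rightarrow> nat \<Rightarrow> nat" where
  "tab_size p q n = q * (if n = 1 then p - 1 else n * (p-1) - 1)"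

text \<open>The leg of the \<open>n\<close>-th hook: \<open>d\<close> describes the first hook, and \<open>x m\<close> counts the units of
  \<open>q\<close> nodes which the block number \<open>2 * m + 1\<close> adds to the first column. The legs of the
  even hooks are forced modulo their residue \<open>w\<close>, as \<open>V\<close> leaves room for one multiple of \<open>q\<close> only.\<close>

definition tab_leg :: "nat \<Rightarrow> nat \<Rightarrow> nat \<Rightarrow> nat \<Rightarrow> (nat \<Rightarrow> nat) \<Rightarrow> nat \<Rightarrow> nat" where
  "tab_leg p q w d x n =
     (if n = 1 then q * d
      else if even n then q * (n div 2 * (p-1) - 1)
      else q * (n div 2 * (p-1) - 1 + x (n div 2))) + w"

definition tab :: "nat \<Rightarrow> nat \<Rightarrow> nat \<Rightarrow> nat \<Rightarrow> nat \<Rightarrow> (nat \<Rightarrow> nat) \<Rightarrow> nat list list" where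
  "tab p q s w d x = map (\<lambda>n. hook (tab_size p q n) (tab_leg p q w d x n)) [1..<2*s+1]"

text \<open>Extensional functions make the set finite and let distinct parameters give distinct
  tableaux.\<close>

definition tab_params :: "nat \<Rightarrow> nat \<Rightarrow> (nat \<times> (nat \<Rightarrow> nat)) set" where
  "tab_params p s = {..<p-1} \<times> ({1..<s} \<rightarrow>\<^sub>E {..<p})"

lemma card_tab_params: "s \<ge> 1 \<Longrightarrow> card (tab_params p s) = p^(s-1) * (p-1)"
  by (simp add: tab_params_def card_cartesian_product card_PiE)

lemma length_tab [simp]: "length (tab p q s w d x) = 2 * s"
  by (simp add: tab_def)

lemma step_tab:
  assumes "1 \<le> n" "n \<le> 2 * s"
  shows "step (tab p q s w d x) n = hook (tab_size p q n) (tab_leg p q w d x n)"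
proof -
  have "[1..<2*s+1] ! (n - 1) = n" using assms by (subst nth_upt) auto
  then show ?thesis using assms by (simp add: step_def tab_def del: upt_Suc)
qed

lemma last_tab:
  assumes "s \<ge> 1"
  shows "last (tab p q s w d x) = V_hook p q s w"
proof -
  have "last (tab p q s w d x) = step (tab p q s w d x) (2*s)"
    using assms by (subst last_conv_nth) (auto simp: step_def simp flip: length_0_conv)
  then show ?thesis using assms by (simp add: step_tab V_hook_def tab_size_def tab_leg_def)
qed

text \<open>Secures that the hooks are genuine partitions, as \<open>add_block_hook\<close>
  demands.\<close>

lemma tab_leg_less:
  assumes "p \<ge> 3" "n \<ge> 1" "w < q" "d < p - 1" "odd n \<Longrightarrow> n > 1 \<Longrightarrow> x (n div 2) < p"
  shows "tab_leg p q w d x n < tab_size p q n"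
proof (cases "n = 1")
  case True
  then show ?thesis using assms by (simp add: tab_leg_def tab_size_def mult_add_less)
next
  case False
  define m where "m = n div 2"
  define c where "c = p - 1"
  have "m \<ge> 1" using False assms by (simp add: m_def)
  then have mc: "m * c \<ge> 1" using assms by (simp add: c_def)
  show ?thesis
  proof (cases "even n")
    case True
    then have "n * c = m * c + m * c" by (auto simp: m_def)
    then have "m * c - 1 < n * c - 1" using mc by linarith
    then show ?thesis using True False assms
      by (simp add: tab_leg_def tab_size_def mult_add_less m_def c_def)
  next
    case odd: False
    then have "n = 2 * m + 1" by (simp add: m_def)
    then have "n * c = m * c + m * c + c" by (simp add: algebra_simps)
    moreover have "x m \<le> c" using assms odd False by (simp add: m_def c_def)
    ultimately have "m * c - 1 + x m < n * c - 1" using mc by linarith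
    then show ?thesis using odd False assms
      by (simp add: tab_leg_def tab_size_def mult_add_less m_def c_def)
  qed
qed

section \<open>Blocks between consecutive hooks\<close>

lemma add_block_hook_mult:
  assumes "i < k" "t \<le> c"
  shows "add_block (q * (c - t)) (q * t) (hook k i) = hook (k + q * c) (i + q * t)"
  using assms by (simp add: add_block_hook add.assoc flip: distrib_left)

lemma tab_step2:
  assumes "p \<ge> 3" "w < q" "d < p - 1"
  shows "hook (tab_size p q 2) (tab_leg p q w d x 2)
       = add_block (q * (p-2-(p-2-d))) (q * (p-2-d)) (hook (tab_size p q 1) (tab_leg p q w d x 1))"
proof -
  have "2*(p-1) - 1 = (p-1) + (p-2)" "1*(p-1) - 1 = d + (p-2-d)" using assms by auto
  then have "q * (2*(p-1) - 1) = q * (p-1) + q * (p-2)" "q * (1*(p-1) - 1) = q * d + q * (p-2-d)"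
    by (simp_all only: distrib_left)
  then have "tab_size p q 2 = tab_size p q 1 + q * (p-2)"
    and "tab_leg p q w d x 2 = tab_leg p q w d x 1 + q * (p-2-d)"
    by (simp_all add: tab_size_def tab_leg_def)
  moreover have "tab_leg p q w d x 1 < tab_size p q 1" "p-2-d \<le> p-2"
    using assms by (auto intro!: tab_leg_less)
  ultimately show ?thesis by (simp only: add_block_hook_mult)
qed

lemma tab_step_odd:
  assumes "p \<ge> 3" "w < q" "d < p - 1" "m \<ge> 1" "x m < p"
  shows "hook (tab_size p q (2*m+1)) (tab_leg p q w d x (2*m+1))
       = add_block (q * (p-1-x m)) (q * x m) (hook (tab_size p q (2*m)) (tab_leg p q w d x (2*m)))"
proof -
  define c where "c = p - 1"
  have "m * c \<ge> 1" using assms by (simp add: c_def)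
  moreover have "(2*m+1)*c = m*c + m*c + c" "2*m*c = m*c + m*c" by (simp_all add: algebra_simps)
  ultimately have "(2*m+1)*c - 1 = (2*m*c - 1) + c" by linarith
  then have "tab_size p q (2*m+1) = tab_size p q (2*m) + q * (p-1)"
    using assms by (simp add: tab_size_def c_def flip: distrib_left)
  moreover have "tab_leg p q w d x (2*m+1) = tab_leg p q w d x (2*m) + q * x m"
    using assms by (simp add: tab_leg_def distrib_left del: add_diff_assoc2)
  moreover have "tab_leg p q w d x (2*m) < tab_size p q (2*m)" "x m \<le> p-1"
    using assms by (auto intro!: tab_leg_less)
  ultimately show ?thesis by (simp only: add_block_hook_mult)
qed

text \<open>From one even hook to the next the leg must grow by \<open>p - 1\<close> units of
  \<open>q\<close>. As the odd hook has taken \<open>x m\<close> of them, the block to the even hook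
  supplies the rest. The double subtraction fits the form of \<open>is_chain\<close>.\<close>

lemma tab_step_even:
  assumes "p \<ge> 3" "w < q" "d < p - 1" "m \<ge> 1" "x m < p"
  shows "hook (tab_size p q (2*m+2)) (tab_leg p q w d x (2*m+2))
       = add_block (q * (p-1-(p-1-x m))) (q * (p-1-x m))
           (hook (tab_size p q (2*m+1)) (tab_leg p q w d x (2*m+1)))"
proof -
  define c where "c = p - 1"
  have mc: "m * c \<ge> 1" "x m \<le> c" using assms by (auto simp: c_def)
  have "(2*m+1)*c = m*c + m*c + c" "(2*m+2)*c = m*c + m*c + c + c"
    by (simp_all add: algebra_simps)
  with mc have "(2*m+2)*c - 1 = ((2*m+1)*c - 1) + c" by linarith
  then have "q * ((2*m+2)*c - 1) = q * ((2*m+1)*c - 1) + q * c" by (simp only: distrib_left)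
  then have "tab_size p q (2*m+2) = tab_size p q (2*m+1) + q * (p-1)"
    using assms(4) unfolding tab_size_def c_def by simp
  moreover have "tab_leg p q w d x (2*m+2) = tab_leg p q w d x (2*m+1) + q * (p-1-x m)"
  proof -
    have "Suc m * c - 1 = (m*c - 1 + x m) + (c - x m)" using mc by (simp only: mult_Suc)
    then have "q * (Suc m * c - 1) = q * (m*c - 1 + x m) + q * (c - x m)"
      by (simp only: distrib_left)
    moreover have "tab_leg p q w d x (2*m+2) = q * (Suc m * c - 1) + w"
      by (simp add: tab_leg_def c_def del: mult_Suc)
    moreover have "tab_leg p q w d x (2*m+1) = q * (m*c - 1 + x m) + w"
      using assms(4) by (simp add: tab_leg_def c_def del: add_diff_assoc2)
    ultimately show ?thesis by (simp only: c_def)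
  qed
  moreover have "tab_leg p q w d x (2*m+1) < tab_size p q (2*m+1)" "p-1-x m \<le> p-1"
    using assms by (auto intro!: tab_leg_less)
  ultimately show ?thesis by (simp only: add_block_hook_mult)
qed

section \<open>Chains are exactly the parametrized tableaux\<close>

lemma is_chain_tab:
  assumes p: "p \<ge> 3" and s: "s \<ge> 1" and q: "q = p^(r-s)" and w: "w < q"
    and dx: "(d, x) \<in> tab_params p s"
  shows "is_chain p r s (tab p q s w d x)"
proof -
  let ?T = "tab p q s w d x"
  have d: "d < p - 1" and x: "\<And>m. 1 \<le> m \<Longrightarrow> m < s \<Longrightarrow> x m < p"
    using dx by (auto simp: tab_params_def)
  have W: "step ?T (2*m - 1) \<in> W p (r - s + m) (m - 1)" if m: "m \<in> {1..s}" for m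
  proof (cases "m = 1")
    case True
    have "q * d + w < q * (p-1)" using w d by (rule mult_add_less)
    then show ?thesis using True s by (auto simp: step_tab tab_size_def tab_leg_def W_def q)
  next
    case False
    define k where "k = m - 1"
    have k: "m = Suc k" "k \<ge> 1" "k < s" using m False by (auto simp: k_def)
    define c where "c = p - 1"
    have c: "p = c + 1" "c \<ge> 2" using p by (auto simp: c_def)
    have e: "(2*k+1)*p - 2*(k+1) = (2*k+1)*(p-1) - 1" "k*p - (k+1) = k*(p-1) - 1"
      by (simp_all add: c algebra_simps)
    \<comment> \<open>The bound \<open>x k \<le> p - 1\<close> is just what keeps the leg below the
      upper limit of \<open>W\<close>.\<close>
    have "k * c \<ge> 1" "x k \<le> c" using k c x[of k] by auto
    then have "k * c - 1 + x k < k * c + c" by linarith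
    then have "k * (p-1) - 1 + x k < (k+1) * (p-1)" by (simp add: c)
    then have "q * (k * (p-1) - 1 + x k) + w < q * ((k+1) * (p-1))"
      using w by (rule mult_add_less[rotated])
    moreover have "step ?T (2*k+1) = hook (q * ((2*k+1)*(p-1)-1)) (q * (k * (p-1) - 1 + x k) + w)"
      using k by (simp add: step_tab tab_size_def tab_leg_def)
    moreover have "W p (r-s+m) k = {hook (q * ((2*k+1)*(p-1)-1)) i |i.
        q * (k*(p-1)-1) \<le> i \<and> i < q * ((k+1)*(p-1))}"
    proof -
      \<comment> \<open>The level \<open>r - s + m\<close> grows with \<open>m\<close> so that the
        unit \<open>q\<close> stays the same along the chain.\<close>
      have "r - s + m - k - 1 = r - s" "k \<noteq> 0" using k by auto
      moreover have "(k+1) * p^(r-s) * (p-1) = p^(r-s) * ((k+1) * (p-1))"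
        by (simp only: mult_ac)
      ultimately show ?thesis by (simp only: W_def e q if_False)
    qed
    moreover have "q * (k*(p-1)-1) \<le> q * (k * (p-1) - 1 + x k) + w"
      by (simp add: distrib_left)
    moreover have "2*m-1 = 2*k+1" "m - 1 = k" using k by auto
    ultimately show ?thesis by auto
  qed
  have V: "step ?T (2*m) \<in> V p (r - s + m) m" if m: "m \<in> {1..s}" for m
    using m w p by (auto simp: step_tab V_eq V_hook_def q tab_size_def tab_leg_def)
  have S2: "\<exists>t\<in>{0..p-2}. step ?T 2 = add_block (q * (p-2-t)) (q * t) (step ?T 1)"
    using s d tab_step2[OF p w d, of x]
    by (intro bexI[of _ "p-2-d"]) (auto simp: step_tab)
  have S: "\<exists>t\<in>{0..p-1}. step ?T n = add_block (q * (p-1-t)) (q * t) (step ?T (n - 1))"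
    if n: "n \<in> {3..2*s}" for n
  proof (cases "even n")
    case True
    define m where "m = n div 2 - 1"
    have m: "n = 2*m+2" "m \<ge> 1" "m < s" using True n by (auto simp: m_def elim!: evenE)
    show ?thesis
      using tab_step_even[OF p w d m(2) x] m n
      by (intro bexI[of _ "p-1-x m"]) (auto simp: step_tab)
  next
    case False
    define m where "m = n div 2"
    have m: "n = 2*m+1" "m \<ge> 1" "m < s" using False n by (auto simp: m_def elim!: oddE)
    show ?thesis
      using tab_step_odd[OF p w d m(2) x] m n x[of m]
      by (intro bexI[of _ "x m"]) (auto simp: step_tab)
  qed
  show ?thesis
    unfolding is_chain_def using W V S2 S by (simp add: q)
qed

text \<open>Converse of \<open>is_chain_tab\<close>: every block changes the leg by a multiple of
  \<open>q\<close>, so the residue \<open>w\<close> of the last leg holds along the whole chain and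
  fixes the even hooks. The remaining freedom is recorded by \<open>d\<close> and
  \<open>x\<close>.\<close>

lemma is_chain_cases:
  assumes p: "p \<ge> 3" and s: "s \<ge> 1" and q: "q = p^(r-s)" and w: "w < q"
    and T: "is_chain p r s T" and lT: "last T = V_hook p q s w"
  obtains d x where "(d, x) \<in> tab_params p s" "T = tab p q s w d x"
proof -
  define L where "L n = hook_leg (step T n)" for n
  have len: "length T = 2 * s"
    and WV: "\<And>m. m \<in> {1..s} \<Longrightarrow> step T (2*m - 1) \<in> W p (r - s + m) (m - 1) \<and>
                 step T (2*m) \<in> V p (r - s + m) m"
    and S2: "\<exists>t\<in>{0..p-2}. step T 2 = add_block (q * (p-2-t)) (q * t) (step T 1)"
    and S: "\<And>n. n \<in> {3..2*s} \<Longrightarrow> \<exists>t\<in>{0..p-1}.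
        step T n = add_block (q * (p-1-t)) (q * t) (step T (n - 1))"
    using T by (auto simp: is_chain_def q)
  have last: "step T (2*s) = V_hook p q s w"
    using lT s len by (metis last_conv_nth length_0_conv mult_is_0 not_one_le_zero step_def zero_neq_numeral)
  have V: "\<exists>v<q. step T (2*m) = V_hook p q m v" if "m \<in> {1..s}" for m
    using WV[OF that] that p by (auto simp: V_eq q)
  have step1: "step T 1 = hook (q * (p-1)) (L 1)" "L 1 < q * (p-1)"
    using WV[of 1] s by (auto simp: W_def q L_def)
  have leg_add: "hook_leg (add_block a b lam) = hook_leg lam + b" if "lam \<noteq> []" for a b lam
    using that by (cases lam) (auto simp: hook_leg_def add_block_def)
  have ne: "step T n \<noteq> []" if n: "1 \<le> n" "n \<le> 2*s" for n
  proof (cases "n < 3")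
    case True
    then have "n = 1 \<or> n = 2" using n by linarith
    then show ?thesis using step1 S2 by (auto simp: hook_def add_block_def)
  next
    case False
    then show ?thesis using S[of n] n by (auto simp: add_block_def)
  qed
  have Lstep: "\<exists>t\<le>p-1. L n = L (n-1) + q * t" if n: "2 \<le> n" "n \<le> 2*s" for n
  proof (cases "n = 2")
    case True
    obtain t where "t \<le> p-2" "step T 2 = add_block (q * (p-2-t)) (q * t) (step T 1)"
      using S2 by auto
    then show ?thesis
      using True n ne[of 1] by (intro exI[of _ t]) (auto simp: L_def leg_add)
  next
    case False
    then obtain t where "t \<le> p-1" "step T n = add_block (q * (p-1-t)) (q * t) (step T (n-1))"
      using S[of n] n by auto
    then show ?thesis
      using n ne[of "n-1"] by (intro exI[of _ t]) (auto simp: L_def leg_add)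
  qed
  have Lmod1: "L n mod q = L 1 mod q" if "1 \<le> n" "n \<le> 2*s" for n
    using that
  proof (induction n)
    case (Suc n)
    show ?case
    proof (cases "n = 0")
      case False
      then show ?thesis using Lstep[of "Suc n"] Suc by auto
    qed simp
  qed simp
  have Lmod: "L n mod q = w" if "1 \<le> n" "n \<le> 2*s" for n
  proof -
    have "L (2*s) mod q = w" using w by (simp add: L_def last V_hook_def)
    then show ?thesis using Lmod1[OF that] Lmod1[of "2*s"] s by simp
  qed
  \<comment> \<open>The offset of a shape in \<open>V\<close> is the residue of its leg modulo
    \<open>q\<close>, so it can only be \<open>w\<close>.\<close>
  have even_step: "step T (2*m) = V_hook p q m w" if m: "m \<in> {1..s}" for m
  proof -
    obtain v where v: "v < q" "step T (2*m) = V_hook p q m v" using V[OF m] by blast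
    then have "L (2*m) mod q = v" by (simp add: L_def V_hook_def)
    then show ?thesis using v Lmod[of "2*m"] m by simp
  qed
  define d where "d = L 1 div q"
  \<comment> \<open>The number of units added to the leg by the block to hook \<open>2*m+1\<close>,
    restricted to \<open>{1..<s}\<close> to be extensional.\<close>
  define x where "x = (\<lambda>m\<in>{1..<s}. (L (2*m+1) - L (2*m)) div q)"
  have L1: "L 1 = q * d + w"
    using Lmod[of 1] s mult_div_mod_eq[of q "L 1"] by (simp add: d_def)
  have d: "d < p - 1" using step1(2) by (simp add: d_def less_mult_imp_div_less mult.commute)
  have x: "x m < p \<and> step T (2*m+1) = hook (tab_size p q (2*m+1)) (tab_leg p q w d x (2*m+1))"
    if m: "1 \<le> m" "m < s" for m
  proof -
    obtain t where t: "t \<le> p-1" "step T (2*m+1) = add_block (q * (p-1-t)) (q * t) (step T (2*m))"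
      using S[of "2*m+1"] m by auto
    have e: "step T (2*m) = hook (tab_size p q (2*m)) (tab_leg p q w d x (2*m))"
      using even_step[of m] m by (simp add: V_hook_def tab_size_def tab_leg_def)
    have "L (2*m+1) = L (2*m) + q * t"
      using t ne[of "2*m"] m by (simp add: L_def leg_add)
    then have "x m = t" using m w by (simp add: x_def)
    then show ?thesis using t tab_step_odd[OF p w d m(1), of x] p e by auto
  qed
  have "T = tab p q s w d x"
  proof (rule nth_equalityI)
    fix i assume "i < length T"
    then have i: "1 \<le> i+1" "i+1 \<le> 2*s" using len by auto
    have "step T (i+1) = hook (tab_size p q (i+1)) (tab_leg p q w d x (i+1))"
    proof (cases "i = 0")
      case True
      then show ?thesis using step1(1) L1 by (simp add: tab_size_def tab_leg_def)
    next
      case i0: False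
      show ?thesis
      \<comment> \<open>List index \<open>i\<close> holds hook \<open>i + 1\<close>, so the even
        indices \<open>i > 0\<close> carry the free odd hooks.\<close>
      proof (cases "even i")
        case True
        then obtain m where "i = 2*m" by (auto elim: evenE)
        then show ?thesis using x[of m] i i0 by auto
      next
        case False
        then obtain m where m: "i = 2*m+1" by (auto elim: oddE)
        then have "step T (2*(m+1)) = V_hook p q (m+1) w" using i by (intro even_step) auto
        then show ?thesis using m by (simp add: V_hook_def tab_size_def tab_leg_def del: mult_Suc)
      qed
    qed
    then have "step T (i+1) = step (tab p q s w d x) (i+1)" by (simp only: step_tab[OF i])
    then show "T ! i = tab p q s w d x ! i" by (simp add: step_def)
  qed (simp add: len)
  moreover have "(d, x) \<in> tab_params p s"
    using d x by (auto simp: tab_params_def) (auto simp: x_def)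
  ultimately show ?thesis using that by blast
qed

section \<open>Numbers of tableaux and shapes\<close>

text \<open>The number of a block type minus one, where the block adds \<open>q * (p - 1 - y)\<close> nodes to the
  first column.\<close>

definition block_digit :: "nat \<Rightarrow> nat \<Rightarrow> nat" where
  "block_digit p y = (if y < (p-1) div 2 then 2 * ((p-1) div 2 - y) - 1 else 2 * (y - (p-1) div 2))"

text \<open>The index \<open>i\<^sub>r\<close> minus one, as a function of the leg \<open>u\<close>
  of the first hook.\<close>

definition first_digit :: "nat \<Rightarrow> nat \<Rightarrow> nat" where
  "first_digit p u = (if u < (p-1) div 2 then 2*u else 2 * (p-2-u) + 1)"

text \<open>The value of \<open>nu\<close> at the balanced digit \<open>y - (p-1) div 2\<close>, for
  an ordinary base-\<open>p\<close> digit \<open>y\<close>.\<close>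

definition nu_digit :: "nat \<Rightarrow> nat \<Rightarrow> nat" where
  "nu_digit p y = (if y \<le> (p-1) div 2 then 2 * ((p-1) div 2 - y) else 2 * (y - (p-1) div 2) - 1)"

text \<open>In each map the two branches are injective and take values of opposite parity. Here
  \<open>c\<close> stands for \<open>(p-1) div 2\<close>, which leaves linear arithmetic
  only.\<close>

lemma zigzag_inj:
  fixes c y z :: nat
  shows "y < 2*c + 1 \<Longrightarrow> z < 2*c + 1 \<Longrightarrow>
      (if y < c then 2 * (c-y) - 1 else 2 * (y-c)) = (if z < c then 2 * (c-z) - 1 else 2 * (z-c)) \<Longrightarrow> y = z"
    and "y < 2*c \<Longrightarrow> z < 2*c \<Longrightarrow>
      (if y < c then 2*y else 2 * (2*c + 1 - 2 - y) + 1) = (if z < c then 2*z else 2 * (2*c + 1 - 2 - z) + 1) \<Longrightarrow> y = z"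
    and "y < 2*c + 1 \<Longrightarrow> z < 2*c + 1 \<Longrightarrow>
      (if y \<le> c then 2 * (c-y) else 2 * (y-c) - 1) = (if z \<le> c then 2 * (c-z) else 2 * (z-c) - 1) \<Longrightarrow> y = z"
  by (simp split: if_splits; arith)+

context
  fixes p :: nat
  assumes p: "odd p" "p \<ge> 3"
begin

lemma half_eq: "p - 1 = 2 * ((p-1) div 2)"
  using p by auto

lemma digit_less:
  "y < p \<Longrightarrow> block_digit p y < p"
  "y < p - 1 \<Longrightarrow> first_digit p y < p - 1"
  "y < p \<Longrightarrow> nu_digit p y < p"
proof -
  obtain c where "p = 2 * c + 1" using p(1) by (auto elim: oddE)
  then show "y < p \<Longrightarrow> block_digit p y < p" "y < p - 1 \<Longrightarrow> first_digit p y < p - 1"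
    "y < p \<Longrightarrow> nu_digit p y < p"
    by (simp_all add: block_digit_def first_digit_def nu_digit_def) linarith+
qed

lemma digit_inj:
  "y < p \<Longrightarrow> z < p \<Longrightarrow> block_digit p y = block_digit p z \<Longrightarrow> y = z"
  "y < p - 1 \<Longrightarrow> z < p - 1 \<Longrightarrow> first_digit p y = first_digit p z \<Longrightarrow> y = z"
  "y < p \<Longrightarrow> z < p \<Longrightarrow> nu_digit p y = nu_digit p z \<Longrightarrow> y = z"
proof -
  obtain c where c: "p = 2 * c + 1" using p(1) by (auto elim: oddE)
  have "block_digit p v = (if v < c then 2 * (c - v) - 1 else 2 * (v - c))"
    and "first_digit p v = (if v < c then 2 * v else 2 * (2 * c + 1 - 2 - v) + 1)"
    and "nu_digit p v = (if v \<le> c then 2 * (c - v) else 2 * (v - c) - 1)" for v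
    by (simp_all add: block_digit_def first_digit_def nu_digit_def c)
  note eqs = this
  show "y = z" if *: "y < p" "z < p" "block_digit p y = block_digit p z"
    by (rule zigzag_inj(1)[OF *[unfolded eqs, unfolded c]])
  show "y = z" if *: "y < p - 1" "z < p - 1" "first_digit p y = first_digit p z"
    by (rule zigzag_inj(2)[OF _ _ *(3)[unfolded eqs]]) (use *(1,2) in \<open>simp_all add: c\<close>)
  show "y = z" if *: "y < p" "z < p" "nu_digit p y = nu_digit p z"
    by (rule zigzag_inj(3)[OF *[unfolded eqs, unfolded c]])
qed

section \<open>Numbers of block types\<close>

lemma add_block_eq_iff:
  "add_block a b lam = add_block a' b' lam \<longleftrightarrow> a = a' \<and> b = b'"
  by (simp add: add_block_def)

text \<open>Comparing the nodes added turns the two clauses of \<open>block_number\<close> into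
  \<open>y = c + m\<close> and \<open>y + m = c\<close>. Exactly one clause is solvable, with a
  single \<open>m\<close>, so the definite description is well defined.\<close>

lemma block_number_add_block:
  assumes "q > 0" "y < p"
  shows "block_number p q lam (add_block (q * (p-1-(p-1-y))) (q * (p-1-y)) lam) = Suc (block_digit p y)"
proof -
  define c where "c = (p-1) div 2"
  have pc: "p - 1 = 2 * c" using half_eq by (simp add: c_def)
  have eq1: "add_block (q * (p-1-(p-1-y))) (q * (p-1-y)) lam = add_block (q * c + q * m) (q * c - q * m) lam
      \<longleftrightarrow> y = c + m" if "m \<le> c" for m
  proof -
    have "q * c + q * m = q * (c + m)" "q * c - q * m = q * (c - m)"
      by (simp_all add: distrib_left right_diff_distrib')
    then have "?thesis \<longleftrightarrow> (q * (p-1-(p-1-y)) = q * (c + m) \<and> q * (p-1-y) = q * (c - m) \<longleftrightarrow> y = c + m)"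
      by (simp only: add_block_eq_iff)
    moreover have "p-1-(p-1-y) = c + m \<and> p-1-y = c - m \<longleftrightarrow> y = c + m"
      using assms that pc by linarith
    ultimately show ?thesis using assms(1) by simp
  qed
  have eq2: "add_block (q * (p-1-(p-1-y))) (q * (p-1-y)) lam = add_block (q * c - q * m) (q * c + q * m) lam
      \<longleftrightarrow> y + m = c" if "m \<le> c" for m
  proof -
    have "q * c + q * m = q * (c + m)" "q * c - q * m = q * (c - m)"
      by (simp_all add: distrib_left right_diff_distrib')
    then have "?thesis \<longleftrightarrow> (q * (p-1-(p-1-y)) = q * (c - m) \<and> q * (p-1-y) = q * (c + m) \<longleftrightarrow> y + m = c)"
      by (simp only: add_block_eq_iff)
    moreover have "p-1-(p-1-y) = c - m \<and> p-1-y = c + m \<longleftrightarrow> y + m = c"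
      using assms that pc by linarith
    ultimately show ?thesis using assms(1) by simp
  qed
  have "block_number p q lam (add_block (q * (p-1-(p-1-y))) (q * (p-1-y)) lam)
      = (THE n. (\<exists>m\<in>{0..c}. n = 2*m + 1 \<and> y = c + m) \<or> (\<exists>m\<in>{1..c}. n = 2*m \<and> y + m = c))"
    unfolding block_number_def c_def[symmetric] using eq1 eq2
    by (intro arg_cong[where f = The] ext) auto
  also have "\<dots> = Suc (block_digit p y)"
  proof (rule the_equality)
    have "y \<le> 2 * c" using assms pc by simp
    then show "(\<exists>m\<in>{0..c}. Suc (block_digit p y) = 2*m + 1 \<and> y = c + m) \<or>
        (\<exists>m\<in>{1..c}. Suc (block_digit p y) = 2*m \<and> y + m = c)"
      unfolding block_digit_def c_def[symmetric]
      by (cases "y < c") (auto intro: bexI[of _ "c - y"] bexI[of _ "y - c"])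
  next
    fix n assume "(\<exists>m\<in>{0..c}. n = 2*m + 1 \<and> y = c + m) \<or> (\<exists>m\<in>{1..c}. n = 2*m \<and> y + m = c)"
    then show "n = Suc (block_digit p y)"
      unfolding block_digit_def c_def[symmetric] by auto
  qed
  finally show ?thesis .
qed

text \<open>The weight of the \<open>n\<close>-th block number in the case \<open>s < r\<close>: the last block carries the
  highest power of \<open>p\<close>.\<close>

definition rot_weight :: "nat \<Rightarrow> nat \<Rightarrow> nat" where
  "rot_weight s n = (if n = 1 then s - 2 else n - 2)"

text \<open>The number of a tableau minus one. Block numbers are counted from the last block
  backwards, hence \<open>x (s-n)\<close>. The one digit below \<open>p - 1\<close> is the leading
  digit if \<open>s = r\<close> and the lowest otherwise.\<close>

definition number_of :: "nat \<Rightarrow> nat \<Rightarrow> nat \<Rightarrow> (nat \<Rightarrow> nat) \<Rightarrow> nat" where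
  "number_of r s d x =
     (if s = r then (\<Sum>n\<in>{1..<s}. p^(n-1) * block_digit p (x (s-n))) + p^(s-1) * first_digit p d
      else d + (p-1) * (\<Sum>n\<in>{1..<s}. p^rot_weight s n * block_digit p (x (s-n))))"

section \<open>Tableau numbers as mixed-radix numbers\<close>

lemma bij_betw_pred: "bij_betw (\<lambda>n. n - 1) {1..<s} {..<s-1::nat}"
  by (rule bij_betw_byWitness[where f' = Suc]) auto

lemma bij_betw_rot_weight: "bij_betw (rot_weight s) {1..<s} {..<s-1}"
proof (rule bij_betw_byWitness[where f' = "\<lambda>k. if k = s - 2 then 1 else k + 2"])
  show "\<forall>a\<in>{1..<s}. (if rot_weight s a = s - 2 then 1 else rot_weight s a + 2) = a"
  proof
    fix n assume "n \<in> {1..<s}"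
    then have "n = 1 \<or> 2 \<le> n \<and> n < s" by auto
    then show "(if rot_weight s n = s - 2 then 1 else rot_weight s n + 2) = n"
      unfolding rot_weight_def by (elim disjE) auto
  qed
  show "\<forall>a'\<in>{..<s-1}. rot_weight s (if a' = s - 2 then 1 else a' + 2) = a'"
    by (simp add: rot_weight_def)
  show "rot_weight s ` {1..<s} \<subseteq> {..<s-1}"
    by (auto simp: rot_weight_def)
  show "(\<lambda>k. if k = s - 2 then 1 else k + 2) ` {..<s-1} \<subseteq> {1..<s}"
    by (auto split: if_splits)
qed

lemma block_digit_param_less:
  assumes "(d, x) \<in> tab_params p s"
  shows "\<forall>n\<in>{1..<s}. block_digit p (x (s-n)) < p"
proof
  fix n assume "n \<in> {1..<s}"
  then have "s - n \<in> {1..<s}" by auto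
  then have "x (s-n) < p" using assms by (auto simp: tab_params_def)
  then show "block_digit p (x (s-n)) < p" by (rule digit_less)
qed

lemma number_of_less:
  assumes "(d, x) \<in> tab_params p s"
  shows "number_of r s d x < p^(s-1) * (p-1)"
proof -
  have d: "d < p - 1" using assms by (simp add: tab_params_def)
  note bd = block_digit_param_less[OF assms]
  show ?thesis
  proof (cases "s = r")
    case True
    have "p^(s-1) * first_digit p d + (\<Sum>n\<in>{1..<s}. p^(n-1) * block_digit p (x (s-n))) < p^(s-1) * (p-1)"
      by (intro mult_add_less digits_less[OF bij_betw_pred bd] digit_less d)
    then show ?thesis using True by (simp add: number_of_def add.commute)
  next
    case False
    have "(p-1) * (\<Sum>n\<in>{1..<s}. p^rot_weight s n * block_digit p (x (s-n))) + d < (p-1) * p^(s-1)"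
      by (intro mult_add_less digits_less[OF bij_betw_rot_weight bd] d)
    then show ?thesis using False by (simp add: number_of_def add.commute mult.commute)
  qed
qed

lemma number_of_inj:
  assumes dx: "(d, x) \<in> tab_params p s" "(d', x') \<in> tab_params p s"
    and eq: "number_of r s d x = number_of r s d' x'"
  shows "d = d' \<and> x = x'"
proof -
  have d: "d < p - 1" "d' < p - 1"
    and x: "x \<in> {1..<s} \<rightarrow>\<^sub>E {..<p}" "x' \<in> {1..<s} \<rightarrow>\<^sub>E {..<p}"
    using dx by (auto simp: tab_params_def)
  note bd = dx[THEN block_digit_param_less]
  \<comment> \<open>Quotient and remainder by \<open>q\<close> separate the
    \<open>first_digit\<close> or \<open>d\<close> part from the block digits; \<open>q\<close> will
    be \<open>p^(s-1)\<close> or \<open>p - 1\<close>.\<close>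
  have split: "a = a' \<and> b = b'" if "q * a + b = q * a' + b'" "b < q" "b' < q" for q a a' b b' :: nat
  proof -
    have "(q * a + b) div q = a" "(q * a' + b') div q = a'" using that(2,3) by auto
    then have "a = a'" using that(1) by metis
    then show ?thesis using that(1) by simp
  qed
  have "d = d' \<and> (\<forall>n\<in>{1..<s}. block_digit p (x (s-n)) = block_digit p (x' (s-n)))"
  proof (cases "s = r")
    case True
    let ?S = "\<lambda>x. \<Sum>n\<in>{1..<s}. p^(n-1) * block_digit p (x (s-n))"
    have "p^(s-1) * first_digit p d + ?S x = p^(s-1) * first_digit p d' + ?S x'"
      using eq True by (simp add: number_of_def add.commute)
    then have *: "first_digit p d = first_digit p d' \<and> ?S x = ?S x'"
      by (rule split) (intro digits_less[OF bij_betw_pred] bd)+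
    show ?thesis
      by (intro conjI ballI digit_inj(2)[OF d] digits_inj[OF bij_betw_pred bd] *[THEN conjunct1] *[THEN conjunct2])
  next
    case False
    let ?S = "\<lambda>x. \<Sum>n\<in>{1..<s}. p^rot_weight s n * block_digit p (x (s-n))"
    have "(p-1) * ?S x + d = (p-1) * ?S x' + d'"
      using eq False by (simp add: number_of_def add.commute)
    then have *: "?S x = ?S x' \<and> d = d'" by (rule split) (fact d)+
    show ?thesis
      by (intro conjI ballI digits_inj[OF bij_betw_rot_weight bd] *[THEN conjunct1] *[THEN conjunct2])
  qed
  then have dd: "d = d'" and bde: "\<And>n. n \<in> {1..<s} \<Longrightarrow> block_digit p (x (s-n)) = block_digit p (x' (s-n))"
    by auto
  have "x m = x' m" if m: "m \<in> {1..<s}" for m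
  proof -
    have "block_digit p (x m) = block_digit p (x' m)" using bde[of "s-m"] m by (simp add: Suc_le_eq)
    moreover have "x m < p" "x' m < p" using x m by auto
    ultimately show ?thesis using digit_inj(1) by blast
  qed
  then have "x = x'" by (rule PiE_ext[OF x])
  then show ?thesis using dd by simp
qed

lemma tableau_number_tab:
  assumes s: "1 \<le> s" "s \<le> r" and q: "q = p^(r-s)" and w: "w < q"
    and dx: "(d, x) \<in> tab_params p s"
  shows "tableau_number p r (tab p q s w d x) = Suc (number_of r s d x)"
proof -
  let ?T = "tab p q s w d x"
  have d: "d < p - 1" and x: "\<And>m. 1 \<le> m \<Longrightarrow> m < s \<Longrightarrow> x m < p"
    using dx by (auto simp: tab_params_def)
  have q0: "q > 0" using w by simp
  have len: "length ?T div 2 = s" by simp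
  define b where "b n = block_number p q (step ?T (2*(s-n+1) - 1)) (step ?T (2*(s-n+1)))" for n
  define u where "u = hook_leg (step ?T 1)"
  have b: "b n = Suc (block_digit p (x (s-n)))" if n: "n \<in> {1..<s}" for n
  proof -
    define m where "m = s - n"
    have m: "1 \<le> m" "m < s" using n by (auto simp: m_def)
    have "step ?T (2*m+2) = add_block (q * (p-1-(p-1-x m))) (q * (p-1-x m)) (step ?T (2*m+1))"
      using tab_step_even[OF p(2) w d m(1), of x, OF x[OF m]] m by (simp add: step_tab)
    then have "b n = block_number p q (step ?T (2*m+1))
        (add_block (q * (p-1-(p-1-x m))) (q * (p-1-x m)) (step ?T (2*m+1)))"
      by (simp add: b_def m_def)
    also have "\<dots> = Suc (block_digit p (x m))"
      by (intro block_number_add_block q0 x m)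
    finally show ?thesis by (simp add: m_def)
  qed
  have u: "u = q * d + w" using s by (simp add: u_def step_tab tab_leg_def)
  show ?thesis
  proof (cases "s = r")
    case True
    \<comment> \<open>For \<open>s = r\<close> the offset \<open>w\<close> must be \<open>0\<close>,
      so the first leg is \<open>d\<close> itself.\<close>
    then have "q = 1" by (simp add: q)
    then have ud: "u = d" using u w by simp
    define i where "i n = (if n = r then (if u < (p-1) div 2 then 2*u + 1 else 2*((p-2-u) + 1)) else b n)" for n
    have ir: "i r = Suc (first_digit p d)" by (simp add: i_def ud first_digit_def)
    have i: "i n = Suc (block_digit p (x (s-n)))" if "n \<in> {1..<s}" for n
      using b[OF that] that True by (simp add: i_def)
    \<comment> \<open>\<open>i 1\<close> enters the number without \<open>- 1\<close>; being
      positive, it is one more than a regular summand for \<open>n = 1\<close>.\<close>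
    have "i 1 \<ge> 1"
    proof (cases "s = 1")
      case True then show ?thesis using ir \<open>s = r\<close> by simp
    next
      case False then show ?thesis using i[of 1] s by simp
    qed
    have "tableau_number p r ?T = i 1 + (\<Sum>n=2..r. p^(n-1) * (i n - 1))"
      unfolding tableau_number_def Let_def len q[symmetric] i_def b_def u_def by (rule if_P[OF True])
    also have "\<dots> = Suc (\<Sum>n=1..r. p^(n-1) * (i n - 1))"
      using \<open>i 1 \<ge> 1\<close> s by (simp add: sum.atLeast_Suc_atMost numeral_2_eq_2)
    also have "{1..r} = insert s {1..<s}" using True s by auto
    also have "Suc (\<Sum>n\<in>\<dots>. p^(n-1) * (i n - 1))
        = Suc (p^(s-1) * first_digit p d + (\<Sum>n\<in>{1..<s}. p^(n-1) * (i n - 1)))"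
      using ir True by simp
    also have "(\<Sum>n\<in>{1..<s}. p^(n-1) * (i n - 1)) = (\<Sum>n\<in>{1..<s}. p^(n-1) * block_digit p (x (s-n)))"
      using i by (intro sum.cong) auto
    finally show ?thesis using True by (simp add: number_of_def)
  next
    case False
    have ud: "u div q = d" using u w by simp
    have "tableau_number p r ?T = 1 + u div q +
        (if s > 1 then p^(s-2) * (p-1) * (b 1 - 1) + (\<Sum>n=1..s-2. p^(n-1) * (p-1) * (b (n+1) - 1)) else 0)"
      unfolding tableau_number_def Let_def len q[symmetric] b_def u_def by (rule if_not_P[OF False])
    also have "(if s > 1 then p^(s-2) * (p-1) * (b 1 - 1) + (\<Sum>n=1..s-2. p^(n-1) * (p-1) * (b (n+1) - 1)) else 0)
        = (p-1) * (\<Sum>n\<in>{1..<s}. p^rot_weight s n * block_digit p (x (s-n)))"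
    proof (cases "s > 1")
      case True
      \<comment> \<open>After an index shift the weights \<open>n - 1\<close> become
        \<open>n - 2\<close>, which is \<open>rot_weight\<close> for \<open>n \<ge> 2\<close>; the
        separate term supplies \<open>n = 1\<close>.\<close>
      have "(\<Sum>n=1..s-2. p^(n-1) * (p-1) * (b (n+1) - 1))
          = (\<Sum>n\<in>{2..<s}. p^rot_weight s n * (p-1) * (b n - 1))"
        by (rule sum.reindex_bij_witness[where i = "\<lambda>n. n - 1" and j = Suc])
           (auto simp: rot_weight_def)
      moreover have "{1..<s} = insert 1 {2..<s}" using True by auto
      ultimately have "p^(s-2) * (p-1) * (b 1 - 1) + (\<Sum>n=1..s-2. p^(n-1) * (p-1) * (b (n+1) - 1))
          = (\<Sum>n\<in>{1..<s}. p^rot_weight s n * (p-1) * (b n - 1))"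
        by (simp add: rot_weight_def)
      also have "\<dots> = (\<Sum>n\<in>{1..<s}. (p-1) * (p^rot_weight s n * block_digit p (x (s-n))))"
        using b by (intro sum.cong) auto
      finally show ?thesis using True by (simp add: sum_distrib_left)
    qed simp
    finally show ?thesis using False ud by (simp add: number_of_def)
  qed
qed

section \<open>Balanced base-\<open>p\<close> expansions and \<open>l_value\<close>\<close>

lemma power_eq_half_sum: "p^n = 1 + 2 * (\<Sum>i=1..n. p^(n-i) * ((p-1) div 2))"
proof (induction n)
  case (Suc n)
  have "(\<Sum>i=1..n. p^(Suc n - i) * ((p-1) div 2)) = p * (\<Sum>i=1..n. p^(n-i) * ((p-1) div 2))"
    by (auto simp: sum_distrib_left Suc_diff_le intro!: sum.cong)
  then have "1 + 2 * (\<Sum>i=1..Suc n. p^(Suc n - i) * ((p-1) div 2))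
      = p * (2 * (\<Sum>i=1..n. p^(n-i) * ((p-1) div 2))) + (1 + 2 * ((p-1) div 2))"
    by simp
  also have "1 + 2 * ((p-1) div 2) = p" using p half_eq by simp
  also have "p * (2 * (\<Sum>i=1..n. p^(n-i) * ((p-1) div 2))) + p
      = p * (1 + 2 * (\<Sum>i=1..n. p^(n-i) * ((p-1) div 2)))"
    by (simp only: distrib_left mult_1_right add.commute)
  finally show ?case by (simp only: Suc[symmetric] power_Suc)
qed simp

lemma bij_betw_rev: "bij_betw (\<lambda>i. n - i) {1..n} {..<n::nat}"
  by (rule bij_betw_byWitness[where f' = "\<lambda>k. n - k"]) auto

text \<open>The subtracted sum is \<open>(p^n - 1) / 2\<close>, the offset at which the leg equals
  the centre \<open>(k - 1) / 2\<close> for a shape of size \<open>k\<close>. So balanced digits of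
  the leg are ordinary digits of \<open>w\<close>, each lowered by
  \<open>(p-1) div 2\<close>.\<close>

lemma V_hook_balanced:
  assumes s: "s \<ge> 1" and w: "w < p^n"
  shows "int (hook_leg (V_hook p (p^n) s w))
       = (int (sum_list (V_hook p (p^n) s w)) - 1) div 2
         + (int w - int (\<Sum>i=1..n. p^(n-i) * ((p-1) div 2)))"
proof -
  define H where "H = (\<Sum>i=1..n. p^(n-i) * ((p-1) div 2))"
  define c where "c = s * (p-1)"
  have q: "int (p^n) = 1 + 2 * int H" unfolding H_def by (subst power_eq_half_sum) simp
  have c: "c \<ge> 1" using s p by (simp add: c_def)
  have "sum_list (V_hook p (p^n) s w) = p^n * (2 * c - 1)"
    unfolding V_hook_def hook_recover(1)[OF V_hook_less[OF p(2) s w]]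
    by (simp only: c_def mult.assoc)
  then have "int (sum_list (V_hook p (p^n) s w)) = int (p^n) * (2 * int c - 1)"
    using c by simp
  also have "\<dots> - 1 = 2 * (int (p^n) * int c - int H - 1)"
    using q by (simp add: algebra_simps)
  finally have "(int (sum_list (V_hook p (p^n) s w)) - 1) div 2 = int (p^n) * int c - int H - 1"
    by simp
  moreover have "hook_leg (V_hook p (p^n) s w) = p^n * (c - 1) + w"
    by (simp only: V_hook_def hook_leg_hook c_def)
  then have "int (hook_leg (V_hook p (p^n) s w)) = int (p^n) * int c - int (p^n) + int w"
    using c by (simp add: right_diff_distrib)
  ultimately show ?thesis using q by (simp add: H_def)
qed

text \<open>Signed digits \<open>e i * j i\<close> correspond to ordinary digits of \<open>w\<close>
  by a shift of \<open>(p-1) div 2\<close>. Uniqueness of the latter settles the definite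
  description, and where the sign is ambiguous \<open>nu\<close> is \<open>0\<close>.\<close>

lemma l_value_V_hook:
  assumes s: "s \<ge> 1" and n: "n = r - s"
    and y: "\<forall>i\<in>{1..n}. y i < p" "(\<Sum>i=1..n. p^(n-i) * y i) = w"
  shows "l_value p r s (V_hook p (p^n) s w) = (p-1) * (\<Sum>i=1..n. p^(n-i) * nu_digit p (y i))"
proof -
  define c where "c = (p-1) div 2"
  define Q where "Q e j \<longleftrightarrow> (\<forall>i\<in>{1..n}. e i \<in> {1, -1} \<and> j i \<le> c) \<and>
      int w - int (\<Sum>i=1..n. p^(n-i) * c) = (\<Sum>i=1..n. e i * int (p^(n-i)) * int (j i))"
    for e :: "nat \<Rightarrow> int" and j :: "nat \<Rightarrow> nat"
  have pc: "p = 2 * c + 1" using p half_eq by (simp add: c_def)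
  have w: "w < p^n" using digits_less[OF bij_betw_rev y(1)] y(2) by simp
  have "l_value p r s (V_hook p (p^n) s w)
      = (THE l. \<exists>e j. Q e j \<and> l = (p-1) * (\<Sum>i=1..n. p^(n-i) * nu (e i) (j i)))"
    unfolding l_value_def V_hook_balanced[OF s w] n[symmetric] Q_def c_def[symmetric]
    by simp
  also have "\<dots> = (p-1) * (\<Sum>i=1..n. p^(n-i) * nu_digit p (y i))"
  proof (rule the_equality)
    define e where "e i = (if y i \<le> c then -1 else 1 :: int)" for i
    define j where "j i = (if y i \<le> c then c - y i else y i - c)" for i
    have ej: "e i * int (j i) = int (y i) - int c" for i by (simp add: e_def j_def)
    have "(\<Sum>i=1..n. e i * int (p^(n-i)) * int (j i)) = (\<Sum>i=1..n. int (p^(n-i)) * (e i * int (j i)))"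
      by (simp add: mult_ac)
    also have "\<dots> = int w - int (\<Sum>i=1..n. p^(n-i) * c)"
      unfolding ej y(2)[symmetric] by (simp add: right_diff_distrib sum_subtractf)
    finally have "Q e j" using y(1) pc by (auto simp: Q_def e_def j_def)
    moreover have "nu (e i) (j i) = nu_digit p (y i)" for i
      unfolding nu_def nu_digit_def c_def[symmetric] by (auto simp: e_def j_def)
    ultimately show "\<exists>e j. Q e j \<and> (p-1) * (\<Sum>i=1..n. p^(n-i) * nu_digit p (y i))
        = (p-1) * (\<Sum>i=1..n. p^(n-i) * nu (e i) (j i))"
      by (intro exI[of _ e] exI[of _ j]) simp
  next
    fix l assume "\<exists>e j. Q e j \<and> l = (p-1) * (\<Sum>i=1..n. p^(n-i) * nu (e i) (j i))"
    then obtain e j where Q: "Q e j" and l: "l = (p-1) * (\<Sum>i=1..n. p^(n-i) * nu (e i) (j i))" by blast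
    \<comment> \<open>The shifted digit; \<open>j i \<le> c\<close> places it in
      \<open>{0..<p}\<close>, so \<open>nat\<close> truncates nothing.\<close>
    define z where "z i = nat (int c + e i * int (j i))" for i
    have ej: "e i = 1 \<or> e i = -1" "j i \<le> c" if "i \<in> {1..n}" for i
      using Q that by (auto simp: Q_def)
    have z: "int (z i) = int c + e i * int (j i) \<and> z i < p" if "i \<in> {1..n}" for i
      using ej[OF that] pc by (auto simp: z_def)
    have "int (\<Sum>i=1..n. p^(n-i) * z i) = (\<Sum>i=1..n. int (p^(n-i)) * (int c + e i * int (j i)))"
      using z by simp
    also have "\<dots> = int (\<Sum>i=1..n. p^(n-i) * c) + (\<Sum>i=1..n. e i * int (p^(n-i)) * int (j i))"
      by (simp add: distrib_left sum.distrib mult_ac)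
    also have "\<dots> = int w" using Q by (simp add: Q_def)
    finally have "(\<Sum>i=1..n. p^(n-i) * y i) = (\<Sum>i=1..n. p^(n-i) * z i)"
      unfolding y(2) by (simp only: of_nat_eq_iff)
    moreover have "\<forall>i\<in>{1..n}. z i < p" using z by blast
    ultimately have yz: "y i = z i" if "i \<in> {1..n}" for i
      using that by (intro digits_inj[OF bij_betw_rev y(1)])
    have "nu (e i) (j i) = nu_digit p (y i)" if "i \<in> {1..n}" for i
    proof -
      have yi: "int (y i) = int c + e i * int (j i)" using z[OF that] yz[OF that] by simp
      from ej(1)[OF that] show ?thesis
      proof
        assume "e i = 1"
        moreover from this have "y i = c + j i" using yi by simp
        ultimately show ?thesis by (simp add: nu_def nu_digit_def c_def)
      next
        assume "e i = -1"
        moreover from this have "c = y i + j i" using yi by simp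
        ultimately show ?thesis unfolding nu_def nu_digit_def c_def[symmetric] by simp
      qed
    qed
    then show "l = (p-1) * (\<Sum>i=1..n. p^(n-i) * nu_digit p (y i))"
      unfolding l by (intro arg_cong2[where f = "(*)"] sum.cong) auto
  qed
  finally show ?thesis .
qed

text \<open>The factor \<open>p - 1\<close> is coprime to \<open>p^(r-s)\<close> and cancels. The
  digit sums left are below the modulus, so their congruence is an equality.\<close>

lemma l_value_inj:
  assumes s: "s \<ge> 1" and w: "w < p^(r-s)" "w' < p^(r-s)"
    and eq: "[l_value p r s (V_hook p (p^(r-s)) s w) = l_value p r s (V_hook p (p^(r-s)) s w')] (mod p^(r-s))"
  shows "w = w'"
proof -
  define n where "n = r - s"
  obtain y where y: "\<forall>i\<in>{1..n}. y i < p" "(\<Sum>i=1..n. p^(n-i) * y i) = w"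
    using digits_ex[OF bij_betw_rev] w(1) n_def by metis
  obtain z where z: "\<forall>i\<in>{1..n}. z i < p" "(\<Sum>i=1..n. p^(n-i) * z i) = w'"
    using digits_ex[OF bij_betw_rev] w(2) n_def by metis
  let ?S = "\<lambda>y. \<Sum>i=1..n. p^(n-i) * nu_digit p (y i)"
  have "[(p-1) * ?S y = (p-1) * ?S z] (mod p^n)"
    using eq l_value_V_hook[OF s n_def y] l_value_V_hook[OF s n_def z] by (simp add: n_def)
  moreover have "coprime (p-1) (p^n)"
    using p coprime_diff_one_left_nat[of p] by simp
  ultimately have "[?S y = ?S z] (mod p^n)" by (simp add: cong_mult_lcancel_nat)
  moreover have ny: "\<forall>i\<in>{1..n}. nu_digit p (y i) < p" "\<forall>i\<in>{1..n}. nu_digit p (z i) < p"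
    using y z by (auto intro!: digit_less)
  ultimately have S: "?S y = ?S z"
    using digits_less[OF bij_betw_rev ny(1)] digits_less[OF bij_betw_rev ny(2)]
    by (intro cong_less_modulus_unique_nat)
  have "y i = z i" if i: "i \<in> {1..n}" for i
    by (rule digit_inj(3)[OF _ _ digits_inj[OF bij_betw_rev ny S i]]) (use y z i in auto)
  then have "(\<Sum>i=1..n. p^(n-i) * y i) = (\<Sum>i=1..n. p^(n-i) * z i)"
    by (intro sum.cong) auto
  then show ?thesis by (simp only: y(2) z(2))
qed

end

section \<open>Counting and the bijection\<close>

definition pairs :: "nat \<Rightarrow> nat \<Rightarrow> (nat list list \<times> nat list list) set" where
  "pairs p r = (\<Union>lam\<in>(\<Union>s\<in>{0..r}. V p r s). SYT p r lam \<times> SYT p r lam)"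

text \<open>From \<open>k\<close> to \<open>k + 1\<close> the size loses a factor \<open>p\<close>,
  while its cofactor grows by only \<open>2 * (p - 1)\<close>, too little to compensate.\<close>

lemma V_size_less:
  fixes p r s s' :: nat
  assumes p: "p \<ge> 3" and s: "1 \<le> s" and less: "s < s'" "s' \<le> r"
  shows "p^(r-s') * (2*s'*(p-1) - 1) < p^(r-s) * (2*s*(p-1) - 1)"
proof -
  have step: "p^(r-Suc k) * (2*Suc k*(p-1) - 1) < p^(r-k) * (2*k*(p-1) - 1)"
    if k: "1 \<le> k" "Suc k \<le> r" for k
  proof -
    define c where "c = p - 1"
    define X where "X = 2*k*c - 1"
    have c: "p = c + 1" "c \<ge> 2" using p by (auto simp: c_def)
    have "k * c \<ge> 1 * c" using k by (intro mult_le_mono1)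
    then have kc: "2*k*c \<ge> 2*c" by linarith
    then have X: "2*Suc k*c - 1 = X + 2*c" "2*c \<le> X + 1" using c by (auto simp: X_def)
    have "X \<ge> 3" using X(2) c(2) by linarith
    then have "c * X \<ge> c * 3" by (intro mult_le_mono2)
    then have "X + 2*c < p * X" using c by simp
    then have "p^(r-Suc k) * (X + 2*c) < p^(r-Suc k) * (p * X)" using p by simp
    also have "\<dots> = p^(r-k) * X" using k by (simp add: Suc_diff_Suc flip: power_Suc2 mult.assoc)
    finally show ?thesis using X(1) by (simp only: X_def c_def)
  qed
  show ?thesis using less
  proof (induction s')
    case (Suc k)
    show ?case
    proof (cases "s = k")
      case True
      then show ?thesis using step[of k] s Suc.prems by blast
    next
      case False
      then have "s < k" using Suc.prems by simp
      then show ?thesis using Suc.IH Suc.prems step[of k] s by (meson Suc_leD le_trans less_imp_le less_trans)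
    qed
  qed simp
qed

lemma sum_list_V:
  assumes "p \<ge> 3" "lam \<in> V p r s"
  shows "sum_list lam = (if s = 0 then p^(r-1) * (p-1) else p^(r-s) * (2*s*(p-1) - 1))"
proof (cases "s = 0")
  case True
  then show ?thesis using assms by (auto simp: V_def hook_recover)
next
  case False
  then obtain w where "w < p^(r-s)" "lam = V_hook p (p^(r-s)) s w" using assms by (auto simp: V_eq)
  then show ?thesis
    using False hook_recover(1)[OF V_hook_less[of p s w "p^(r-s)"]] assms by (simp add: V_hook_def)
qed

text \<open>The size of a shape reveals its family: it is even only for \<open>s = 0\<close> and
  strictly decreasing in \<open>s \<ge> 1\<close>.\<close>

lemma V_unique:
  assumes p: "odd p" "p \<ge> 3" and V: "lam \<in> V p r s" "lam \<in> V p r s'" and s: "s \<le> r" "s' \<le> r"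
  shows "s = s'"
proof -
  have parity: "even (sum_list lam) \<longleftrightarrow> k = 0" if "lam \<in> V p r k" for k
  proof (cases "k = 0")
    case False
    then have "2*k*(p-1) \<ge> 1" using p by simp
    then have "odd (2*k*(p-1) - 1)" using p(2) by simp
    then have "odd (p^(r-k) * (2*k*(p-1) - 1))" using p(1) by (simp only: even_mult_iff even_power) simp
    then show ?thesis using sum_list_V[OF p(2) that] False by simp
  qed (use sum_list_V[OF p(2) that] p(1) in simp)
  show ?thesis
  proof (cases "s = 0")
    case True
    then show ?thesis using parity[OF V(1)] parity[OF V(2)] by simp
  next
    case False
    then have "s' \<noteq> 0" using parity[OF V(1)] parity[OF V(2)] by simp
    with False have "p^(r-s) * (2*s*(p-1) - 1) = p^(r-s') * (2*s'*(p-1) - 1)"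
      using sum_list_V[OF p(2) V(1)] sum_list_V[OF p(2) V(2)] by simp
    then show ?thesis
      using V_size_less[OF p(2), of s s' r] V_size_less[OF p(2), of s' s r] s False \<open>s' \<noteq> 0\<close>
      by (metis less_irrefl less_one linorder_neqE_nat not_le)
  qed
qed

context
  fixes p r :: nat
  assumes p: "odd p" "p \<ge> 3"
begin

lemma SYT_V0:
  assumes "lam \<in> V p r 0"
  shows "SYT p r lam = {[lam]}"
proof -
  have "lam \<notin> V p r s" if "s \<in> {1..r}" for s
    using V_unique[OF p assms, of s] that by auto
  then show ?thesis using assms by (auto simp: SYT_def)
qed

lemma SYT_V_hook:
  assumes s: "1 \<le> s" "s \<le> r" and w: "w < p^(r-s)"
  shows "SYT p r (V_hook p (p^(r-s)) s w) = (\<lambda>(d, x). tab p (p^(r-s)) s w d x) ` tab_params p s"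
    (is "SYT p r ?lam = ?R")
proof -
  have V: "?lam \<in> V p r s" using s w p by (simp add: V_eq)
  then have uniq: "?lam \<in> V p r s' \<longleftrightarrow> s' = s" if "s' \<le> r" for s'
    using V_unique[OF p, of ?lam r s s'] that s by auto
  have "SYT p r ?lam = {T. is_chain p r s T \<and> last T = ?lam}"
    using uniq s by (auto simp: SYT_def)
  also have "\<dots> = ?R"
  proof (intro equalityI subsetI)
    fix T assume "T \<in> {T. is_chain p r s T \<and> last T = ?lam}"
    then show "T \<in> ?R" using is_chain_cases[OF p(2) s(1) refl w] by auto
  next
    fix T assume "T \<in> ?R"
    then show "T \<in> {T. is_chain p r s T \<and> last T = ?lam}"
      using is_chain_tab[OF p(2) s(1) refl w] last_tab[OF s(1)] by auto
  qed
  finally show ?thesis .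
qed

text \<open>The numbers of the tableaux already tell the parameters apart.\<close>

lemma inj_on_tab:
  assumes s: "1 \<le> s" "s \<le> r" and w: "w < p^(r-s)"
  shows "inj_on (\<lambda>(d, x). tab p (p^(r-s)) s w d x) (tab_params p s)"
proof (rule inj_onI, clarify)
  fix d x d' x' assume *: "(d, x) \<in> tab_params p s" "(d', x') \<in> tab_params p s"
    and eq: "tab p (p^(r-s)) s w d x = tab p (p^(r-s)) s w d' x'"
  have "number_of p r s d x = number_of p r s d' x'"
    using tableau_number_tab[OF p s refl w *(1)] tableau_number_tab[OF p s refl w *(2)] eq by simp
  then show "d = d' \<and> x = x'" using number_of_inj[OF p *] by blast
qed

section \<open>Cardinalities\<close>

lemma finite_tab_params: "finite (tab_params p s)"
  by (simp add: tab_params_def finite_PiE)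

lemma card_SYT:
  assumes "lam \<in> V p r s" "s \<le> r"
  shows "finite (SYT p r lam)" "card (SYT p r lam) = (if s = 0 then 1 else p^(s-1) * (p-1))"
proof -
  have "finite (SYT p r lam) \<and> card (SYT p r lam) = (if s = 0 then 1 else p^(s-1) * (p-1))"
  proof (cases "s = 0")
    case True
    then show ?thesis using assms SYT_V0 by simp
  next
    case False
    then obtain w where w: "w < p^(r-s)" "lam = V_hook p (p^(r-s)) s w"
      using assms p by (auto simp: V_eq)
    have s: "1 \<le> s" using False by simp
    show ?thesis
      unfolding w(2) SYT_V_hook[OF s assms(2) w(1)]
      using False card_image[OF inj_on_tab[OF s assms(2) w(1)]] card_tab_params[OF s, of p]
        finite_tab_params[of s] by simp
  qed
  then show "finite (SYT p r lam)" "card (SYT p r lam) = (if s = 0 then 1 else p^(s-1) * (p-1))"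
    by blast+
qed

lemma card_V:
  shows "finite (V p r s)" "card (V p r s) = (if s = 0 then p^(r-1) * (p-1) else p^(r-s))"
proof -
  have "finite (V p r s) \<and> card (V p r s) = (if s = 0 then p^(r-1) * (p-1) else p^(r-s))"
  proof (cases "s = 0")
    case True
    have "V p r s = hook (p^(r-1) * (p-1)) ` {..<p^(r-1) * (p-1)}" using True by (auto simp: V_def)
    moreover have "inj_on (hook (p^(r-1) * (p-1))) {..<p^(r-1) * (p-1)}"
      by (auto intro!: inj_onI dest: arg_cong[of _ _ hook_leg])
    ultimately show ?thesis using True by (simp add: card_image)
  next
    case False
    then have "inj_on (V_hook p (p^(r-s)) s) {..<p^(r-s)}"
      by (intro inj_onI V_hook_inj[OF p(2), of s _ "p^(r-s)"]) auto
    then show ?thesis using False p by (simp add: V_eq card_image)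
  qed
  then show "finite (V p r s)" "card (V p r s) = (if s = 0 then p^(r-1) * (p-1) else p^(r-s))"
    by blast+
qed

text \<open>The sum of the totients of all divisors of \<open>p^n\<close>.\<close>

lemma sum_totients: "1 + (\<Sum>s=1..n. p^(s-1) * (p-1)) = p^n"
proof (induction n)
  case (Suc n)
  have "1 + (\<Sum>s=1..Suc n. p^(s-1) * (p-1)) = p^n + p^n * (p-1)"
    using Suc by simp
  also have "\<dots> = p^n * (1 + (p-1))" by (simp only: distrib_left mult_1_right)
  finally show ?case using p by (simp add: mult.commute)
qed simp

text \<open>Level \<open>s \<ge> 1\<close> has \<open>p^(r-s)\<close> shapes with
  \<open>(p^(s-1) * (p-1))^2\<close> pairs each, which is \<open>p^(r-1) * (p-1)\<close> times the
  totient of \<open>p^s\<close>. Level \<open>0\<close> contributes the term for totient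
  \<open>1\<close>, and \<open>sum_totients\<close> adds up.\<close>

lemma card_pairs:
  assumes "r \<ge> 1"
  shows "finite (pairs p r)" "card (pairs p r) = p^r * (p^(r-1) * (p-1))"
proof -
  define N where "N = p^(r-1) * (p-1)"
  let ?U = "\<Union>s\<in>{0..r}. V p r s"
  let ?S = "\<lambda>lam. SYT p r lam \<times> SYT p r lam"
  have finU: "finite ?U" using card_V(1) by blast
  have finS: "finite (?S lam)" if "lam \<in> ?U" for lam using that card_SYT(1) by auto
  then show "finite (pairs p r)" unfolding pairs_def using finU by blast
  have last: "last T = lam" if "T \<in> SYT p r lam" for T lam
    using that by (auto simp: SYT_def)
  have "card (pairs p r) = (\<Sum>lam\<in>?U. card (?S lam))"
    unfolding pairs_def
  proof (rule card_UN_disjoint[OF finU])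
    show "\<forall>i\<in>?U. \<forall>j\<in>?U. i \<noteq> j \<longrightarrow> ?S i \<inter> ?S j = {}" using last by blast
  qed (use finS in blast)
  also have "\<dots> = (\<Sum>s\<in>{0..r}. \<Sum>lam\<in>V p r s. card (?S lam))"
  proof (rule sum.UNION_disjoint)
    show "\<forall>i\<in>{0..r}. \<forall>j\<in>{0..r}. i \<noteq> j \<longrightarrow> V p r i \<inter> V p r j = {}"
      by (auto dest: V_unique[OF p])
  qed (use card_V(1) in auto)
  also have "\<dots> = (\<Sum>s\<in>{0..r}. if s = 0 then N else N * (p^(s-1) * (p-1)))"
  proof (rule sum.cong[OF refl])
    fix s assume s: "s \<in> {0..r}"
    then have "(\<Sum>lam\<in>V p r s. card (?S lam)) = card (V p r s) * (if s = 0 then 1 else p^(s-1) * (p-1))^2"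
      by (simp add: card_cartesian_product card_SYT power2_eq_square)
    also have "\<dots> = (if s = 0 then N else N * (p^(s-1) * (p-1)))"
    proof (cases "s = 0")
      case False
      then have "r - 1 = (r - s) + (s - 1)" using s by auto
      then have "p^(r-1) = p^(r-s) * p^(s-1)" by (simp only: power_add)
      then show ?thesis using False by (simp add: card_V N_def power2_eq_square mult_ac)
    qed (simp add: card_V N_def)
    finally show "(\<Sum>lam\<in>V p r s. card (?S lam)) = (if s = 0 then N else N * (p^(s-1) * (p-1)))" .
  qed
  also have "{0..r} = insert 0 {1..r}" by auto
  also have "(\<Sum>s\<in>\<dots>. if s = 0 then N else N * (p^(s-1) * (p-1))) = N + N * (\<Sum>s=1..r. p^(s-1) * (p-1))"
    by (simp add: sum_distrib_left)
  also have "\<dots> = N * (1 + (\<Sum>s=1..r. p^(s-1) * (p-1)))" by (simp only: distrib_left mult_1_right)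
  finally show "card (pairs p r) = p^r * (p^(r-1) * (p-1))"
    unfolding sum_totients N_def by (simp only: mult.commute)
qed

section \<open>Values of \<open>h\<close> in normal form\<close>

lemma pairs_cases:
  assumes "P \<in> pairs p r"
  obtains (base) i where "i < p^(r-1) * (p-1)"
      "P = ([hook (p^(r-1) * (p-1)) i], [hook (p^(r-1) * (p-1)) i])"
  | (chain) s w d x d' x' where "1 \<le> s" "s \<le> r" "w < p^(r-s)"
      "(d, x) \<in> tab_params p s" "(d', x') \<in> tab_params p s"
      "P = (tab p (p^(r-s)) s w d x, tab p (p^(r-s)) s w d' x')"
proof -
  obtain s lam where s: "s \<le> r" "lam \<in> V p r s" and P: "P \<in> SYT p r lam \<times> SYT p r lam"
    using assms by (auto simp: pairs_def)
  show thesis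
  proof (cases "s = 0")
    case True
    then obtain i where "i < p^(r-1) * (p-1)" "lam = hook (p^(r-1) * (p-1)) i"
      using s by (auto simp: V_def)
    then show thesis using base P SYT_V0[of lam] s True by auto
  next
    case False
    then obtain w where w: "w < p^(r-s)" "lam = V_hook p (p^(r-s)) s w"
      using s p by (auto simp: V_eq)
    have s1: "1 \<le> s" using False by simp
    show thesis
      using P chain[OF s1 s(1) w(1)] unfolding w(2) SYT_V_hook[OF s1 s(1) w(1)] by auto
  qed
qed

lemma h_map_base:
  assumes "i < p^(r-1) * (p-1)"
  shows "h_map G p r g \<tau> jj ([hook (p^(r-1) * (p-1)) i], T) = \<tau> [^]\<^bsub>G\<^esub> jj i"
proof -
  have "hook (p^(r-1) * (p-1)) i \<in> V p r 0" using assms by (auto simp: V_def)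
  then show ?thesis by (simp add: h_map_def Let_def)
qed

text \<open>In the exponent of \<open>\<tau>\<close> the first bracket depends on the first tableau
  only and the second on the second tableau and the shape, so the first can be cancelled once the
  first tableaux agree.\<close>

lemma h_map_chain:
  fixes G :: "('a, 'b) monoid_scheme" (structure) and t :: nat
  assumes G: "group G" and y: "\<tau> \<in> carrier G" and x: "g \<in> carrier G"
    and ord: "group.ord G \<tau> = p^(r-1) * (p-1)"
    and xy: "inv \<tau> \<otimes> g \<otimes> \<tau> = g [^] t"
    and s: "1 \<le> s" "s \<le> r" and w: "w < p^(r-s)"
    and dx: "(d, f) \<in> tab_params p s" "(d', f') \<in> tab_params p s"
  shows "h_map G p r g \<tau> jj (tab p (p^(r-s)) s w d f, tab p (p^(r-s)) s w d' f')
    = g [^] (p^(r-s) * t^number_of p r s d f) \<otimes>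
      \<tau> [^] ((p^(r-1) * (p-1) - number_of p r s d f + p^(r-1) * (p-1) div 2)
        + (number_of p r s d' f' + p^(s-1) * (p-1) * l_value p r s (V_hook p (p^(r-s)) s w)))"
proof -
  interpret group G by (fact G)
  define a where "a = number_of p r s d f"
  define b where "b = number_of p r s d' f'"
  define c where "c = p^(r-1) * (p-1) div 2"
  define l where "l = l_value p r s (V_hook p (p^(r-s)) s w)"
  let ?S = "tab p (p^(r-s)) s w d f"
  have lam: "last ?S = V_hook p (p^(r-s)) s w" using last_tab s by simp
  have "V_hook p (p^(r-s)) s w \<in> V p r s" using s w p by (simp add: V_eq)
  then have notV0: "last ?S \<notin> V p r 0" using V_unique[OF p, of "last ?S" r s 0] s lam by auto
  have num: "tableau_number p r ?S = Suc a" "tableau_number p r (tab p (p^(r-s)) s w d' f') = Suc b"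
    unfolding a_def b_def using dx by (auto intro!: tableau_number_tab p s w)
  have "h_map G p r g \<tau> jj (?S, tab p (p^(r-s)) s w d' f')
      = \<tau> [^] (- (int (Suc a) - 1)) \<otimes> g [^] (p^(r-s)) \<otimes> \<tau> [^] c \<otimes> \<tau> [^] (Suc b - 1)
        \<otimes> \<tau> [^] (l * p^(s-1) * (p-1))"
    unfolding h_map_def by (simp add: notV0[unfolded lam] Let_def num c_def l_def lam)
  also have "\<tau> [^] (- (int (Suc a) - 1)) = inv (\<tau> [^] a)"
    using y by (simp add: int_pow_neg_int)
  also have "inv (\<tau> [^] a) \<otimes> g [^] (p^(r-s)) \<otimes> \<tau> [^] c \<otimes> \<tau> [^] (Suc b - 1) \<otimes> \<tau> [^] (l * p^(s-1) * (p-1))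
      = inv (\<tau> [^] a) \<otimes> g [^] (p^(r-s)) \<otimes> \<tau> [^] (c + (b + l * p^(s-1) * (p-1)))"
    using x y by (simp add: m_assoc nat_pow_mult add.assoc)
  also have "\<dots> = g [^] (p^(r-s) * t^a) \<otimes> \<tau> [^] (group.ord G \<tau> - a + (c + (b + l * p^(s-1) * (p-1))))"
  proof (rule inv_pow_mult_eq[OF y x xy])
    have "a < p^(s-1) * (p-1)" unfolding a_def by (rule number_of_less[OF p dx(1)])
    also have "\<dots> \<le> p^(r-1) * (p-1)" using s p by (intro mult_le_mono1 power_increasing) auto
    finally show "a \<le> group.ord G \<tau>" by (simp add: ord)
  qed
  finally show ?thesis
    unfolding a_def b_def c_def l_def ord by (simp only: add.assoc mult_ac)
qed

end

theorem theorem3p5: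
  fixes G :: "('a, 'b) monoid_scheme" (structure)
    and p r t :: nat and g \<tau> :: 'a and jj :: "nat \<Rightarrow> nat"
  assumes "prime p" and "odd p" and "r \<ge> 1"
    and "group G" and "g \<in> carrier G" and "\<tau> \<in> carrier G"
    and "group.ord G g = p^r"
    and "group.ord G \<tau> = p^(r-1) * (p-1)"
    and "residue_primroot (p^r) t"
    and "inv \<tau> \<otimes> g \<otimes> \<tau> = g [^] t"
    and "carrier G = {\<tau> [^] i \<otimes> g [^] j | (i :: nat) (j :: nat).
                        i \<in> {1..p^(r-1) * (p-1)} \<and> j \<in> {1..p^r}}"
    and "bij_betw jj {..<p^(r-1) * (p-1)} {..<p^(r-1) * (p-1)}"
  shows "bij_betw (h_map G p r g \<tau> jj)
           (\<Union>lam\<in>(\<Union>s\<in>{0..r}. V p r s). SYT p r lam \<times> SYT p r lam)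
           (carrier G)"
proof -
  interpret group G by fact
  note y = \<open>\<tau> \<in> carrier G\<close> and x = \<open>g \<in> carrier G\<close>
    and xy = \<open>inv \<tau> \<otimes> g \<otimes> \<tau> = g [^] t\<close> and root = \<open>residue_primroot (p^r) t\<close>
  define N where "N = p^(r-1) * (p-1)"
  define h where "h = h_map G p r g \<tau> jj"
  have p3: "p \<ge> 3" using \<open>prime p\<close> \<open>odd p\<close> prime_ge_2_nat[of p] by (cases "p = 2") auto
  note p = \<open>odd p\<close> p3
  have ordg: "group.ord G g = p^r" and ordt: "group.ord G \<tau> = N" using assms N_def by auto
  have tcop: "coprime (p^r) t" "Pocklington.ord (p^r) t = N"
    using root \<open>prime p\<close> \<open>r \<ge> 1\<close> by (simp_all add: residue_primroot_def totient_prime_power N_def)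
  have t: "coprime t p" using tcop(1) \<open>r \<ge> 1\<close> by (simp add: coprime_commute)
  have inj_jj: "inj_on jj {..<N}" and jj: "jj i < N" if "i < N" for i
    using assms(12) that by (auto simp: bij_betw_def N_def)
  have normal_form: "[A = B] (mod p^r) \<and> [m = n] (mod N)"
    if "g [^] A \<otimes> \<tau> [^] m = g [^] B \<otimes> \<tau> [^] n" for A B m n :: nat
    using pow_mult_pow_eqD[OF y x xy _ _ that] tcop unfolding ordg ordt by blast
  \<comment> \<open>Congruent exponents have the same gcd with \<open>p^r\<close>, and that gcd is
    \<open>p^(r-s)\<close> because \<open>t\<close> is prime to \<open>p\<close>.\<close>
  have level: "s = s'" if "[p^(r-s) * t^a = p^(r-s') * t^b] (mod p^r)" "s \<le> r" "s' \<le> r" for s s' a b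
  proof -
    have "p^(r-s) = p^(r-s')"
      using cong_gcd_eq[OF that(1)] that(2,3) t by (simp add: gcd_prime_power_mult)
    then have "r - s = r - s'" using p3 by (subst (asm) power_inject_exp) auto
    then show ?thesis using that by simp
  qed
  have mixed: False
    if "i < N" "1 \<le> s" "s \<le> r" "w < p^(r-s)" "(d, f) \<in> tab_params p s" "(d', f') \<in> tab_params p s"
      and eq: "h ([hook N i], [hook N i]) = h (tab p (p^(r-s)) s w d f, tab p (p^(r-s)) s w d' f')"
    for i s w d f d' f'
  proof -
    have "h ([hook N i], [hook N i]) = \<tau> [^] jj i"
      unfolding h_def N_def by (rule h_map_base[OF p]) (use \<open>i < N\<close> N_def in simp)
    \<comment> \<open>The trivial factor \<open>g [^] (p^r)\<close> makes a power of
      \<open>\<tau>\<close> look like a value of level \<open>0\<close>, which \<open>level\<close>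
      separates from all levels \<open>s \<ge> 1\<close>.\<close>
    also have "\<dots> = g [^] (p^r) \<otimes> \<tau> [^] jj i"
      using x y ordg pow_ord_eq_1[OF x] by simp
    finally have "g [^] (p^r) \<otimes> \<tau> [^] jj i = h (tab p (p^(r-s)) s w d f, tab p (p^(r-s)) s w d' f')"
      using eq by simp
    note normal_form[OF this[unfolded h_def h_map_chain[OF p \<open>group G\<close> y x assms(8) xy that(2-6)]]]
    then have "0 = s" using level[of 0 0 s "number_of p r s d f"] \<open>s \<le> r\<close> by simp
    then show False using \<open>1 \<le> s\<close> by simp
  qed
  have "inj_on h (pairs p r)"
  proof (rule inj_onI)
    fix P P' assume P: "P \<in> pairs p r" and P': "P' \<in> pairs p r" and eq: "h P = h P'"
    from p P show "P = P'"
    proof (cases rule: pairs_cases)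
      case base: (base i)
      from p P' show ?thesis
      proof (cases rule: pairs_cases)
        case base': (base i')
        have "\<tau> [^] jj i = \<tau> [^] jj i'"
          using eq base base' h_map_base[OF p, of _ r G g \<tau> jj] by (simp add: h_def)
        then have "[jj i = jj i'] (mod N)" by (simp add: pow_eq_iff_cong y ordt)
        then have "jj i = jj i'"
          using jj base base' by (intro cong_less_modulus_unique_nat) (auto simp: N_def)
        then have "i = i'" using inj_jj base base' by (auto simp: N_def inj_on_def)
        then show ?thesis using base base' by simp
      next
        case chain
        then show ?thesis using mixed base eq by (metis N_def)
      qed
    next
      case chain: (chain s w d f e k)
      from p P' show ?thesis
      proof (cases rule: pairs_cases)
        case base
        then show ?thesis using mixed chain eq by (metis N_def)
      next
        case chain': (chain s' w' d' f' e' k')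
        define L where "L w = l_value p r s (V_hook p (p^(r-s)) s w)" for w
        define M where "M = p^(s-1) * (p-1)"
        have NM: "N = M * p^(r-s)"
        proof -
          have "r - 1 = (s - 1) + (r - s)" using chain by simp
          then have "p^(r-1) = p^(s-1) * p^(r-s)" by (metis power_add)
          then show ?thesis by (simp add: N_def M_def mult_ac)
        qed
        note nf = normal_form[OF eq[unfolded chain(6) chain'(6) h_def
              h_map_chain[OF p \<open>group G\<close> y x assms(8) xy chain(1-5)]
              h_map_chain[OF p \<open>group G\<close> y x assms(8) xy chain'(1-5)]]]
        have s: "s' = s" using level[OF nf[THEN conjunct1]] chain chain' by simp
        note chain' = chain'[unfolded s] and nf = nf[unfolded s, folded N_def M_def L_def]
        have pr: "p^r = p^(r-s) * p^s" using chain by (simp flip: power_add)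
        \<comment> \<open>Cancelling \<open>p^(r-s)\<close> from the exponents of \<open>g\<close>
          leaves powers of \<open>t\<close> modulo \<open>p^s\<close>.\<close>
        have "[t^number_of p r s d f = t^number_of p r s d' f'] (mod p^s)"
          using nf[THEN conjunct1] p3 unfolding pr by (simp add: cong_def mult_mod_right[symmetric])
        then have "[number_of p r s d f = number_of p r s d' f'] (mod M)"
          unfolding M_def using residue_primroot_prime_power_cong[OF \<open>prime p\<close> root] chain by simp
        then have a: "number_of p r s d f = number_of p r s d' f'"
          using number_of_less[OF p] chain chain' unfolding M_def
          by (intro cong_less_modulus_unique_nat)
        then have df: "d = d' \<and> f = f'" using number_of_inj[OF p] chain chain' by blast
        have m: "[number_of p r s e k + M * L w = number_of p r s e' k' + M * L w'] (mod N)"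
          using nf[THEN conjunct2] unfolding a by (simp only: cong_add_lcancel_nat)
        \<comment> \<open>\<open>M\<close> divides \<open>N\<close>, and modulo \<open>M\<close> the
          shape term vanishes, which isolates the number of the second tableau.\<close>
        then have "[number_of p r s e k + M * L w = number_of p r s e' k' + M * L w'] (mod M)"
          by (rule cong_dvd_modulus_nat) (simp add: NM)
        then have "[number_of p r s e k = number_of p r s e' k'] (mod M)"
          by (simp add: cong_def)
        then have b: "number_of p r s e k = number_of p r s e' k'"
          using number_of_less[OF p] chain chain' unfolding M_def
          by (intro cong_less_modulus_unique_nat)
        then have ek: "e = e' \<and> k = k'" using number_of_inj[OF p] chain chain' by blast
        \<comment> \<open>Dividing by \<open>M\<close> leaves \<open>L\<close> modulo
          \<open>p^(r-s)\<close>, which is all that the order of \<open>\<tau>\<close> lets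
          through.\<close>
        have "[M * L w = M * L w'] (mod M * p^(r-s))"
          using m unfolding b NM by (simp only: cong_add_lcancel_nat)
        moreover have "M > 0" using p3 by (simp add: M_def)
        ultimately have "[L w = L w'] (mod p^(r-s))"
          by (simp add: cong_def mult_mod_right[symmetric])
        then have "w = w'" using l_value_inj[OF p] chain chain' unfolding L_def by blast
        then show ?thesis using chain(6) chain'(6) df ek by simp
      qed
    qed
  qed
  moreover have "h ` pairs p r \<subseteq> carrier G"
  proof (intro image_subsetI)
    fix P assume "P \<in> pairs p r"
    with p show "h P \<in> carrier G"
    proof (cases rule: pairs_cases)
      case (base i)
      then show ?thesis using h_map_base[OF p, of i r G g \<tau> jj] y by (simp add: h_def)
    next
      case (chain s w d f d' f')
      then show ?thesis
        using h_map_chain[OF p \<open>group G\<close> y x assms(8) xy chain(1-5)] x y by (simp add: h_def)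
    qed
  qed
  \<comment> \<open>An upper bound is enough here, since injectivity of \<open>h\<close> gives the
    reverse inequality.\<close>
  moreover have "finite (carrier G) \<and> card (carrier G) \<le> card (pairs p r)"
  proof -
    have *: "carrier G = (\<lambda>(i, j). \<tau> [^] i \<otimes> g [^] j) ` ({1..N} \<times> {1..p^r})"
      unfolding assms(11) N_def by auto blast
    have "card (carrier G) \<le> card ({1..N} \<times> {1..p^r})" unfolding * by (rule card_image_le) simp
    then show ?thesis
      using card_pairs(2)[OF p \<open>r \<ge> 1\<close>] * by (simp add: N_def mult.commute)
  qed
  ultimately have "bij_betw h (pairs p r) (carrier G)"
    by (metis bij_betw_def card_image card_mono card_subset_eq le_antisym)
  then show ?thesis by (simp only: h_def pairs_def)
qed

end
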